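(* Let $G$ be a locally compact, compactly generated group, equipped with the word length metric relative to a compact generating subset. Then for every $p\geq 1$ we have $\alpha^*_p(G)\geq \alpha^*_2(G)$.
   Context: All groups are locally compact (Hausdorff) and compactly generated; $d$ denotes the word length metric on $G$ relative to a fixed compact generating subset (the invariants below do not depend on this choice). For $p\geq 1$, a map $f:G\to L_p(\Omega,\mu)$ (for some measure space $(\Omega,\mu)$) is $G$-equivariant if there is a continuous affine isometric action $\alpha$ of $G$ on $L_p(\Omega,\mu)$ with $f(gh)=\alpha(g)(f(h))$ for all $g,h\in G$. A map $f:G\to L_p(\Omega,\mu)$ is a coarse embedding if there are a non-decreasing $\rho_-:\mathbb{R}^+\to\mathbb{R}^+$ with $\rho_-(t)\to\infty$ and $C>0$ such that $\rho_-(d(g,h))\leq\|f(g)-f(h)\|_p\leq C\,d(g,h)$ for all $g,h$. The $L_p$-compression $R(f)$ of a coarse embedding $f$ is the supremum of $r\in[0,1]$ such that there exist $C,D>0$ with $\frac1C d(g,h)^r-D\leq\|f(g)-f(h)\|\leq C d(g,h)$ for all $g,h\in G$. The equivariant $L_p$-compression $\alpha^*_p(G)$ is the supremum of $R(f)$ over all $G$-equivariant coarse embeddings $f$ of $G$ into all $L_p$-spaces (taken to be $0$ if there are none). *)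

theory Defs
  imports "HOL-Analysis.Analysis" "HOL-Probability.Probability"
begin

text \<open>Groups are modelled as types of class topological_group_add (group written
additively, not necessarily commutative) which are Hausdorff (t2_space).\<close>

definition generates :: "'g::group_add set \<Rightarrow> bool" where
  "generates S \<longleftrightarrow> (\<forall>x. \<exists>xs. set xs \<subseteq> S \<union> uminus ` S \<and> sum_list xs = x)"

definition word_length :: "'g::group_add set \<Rightarrow> 'g \<Rightarrow> nat" where
  "word_length S x = (LEAST n. \<exists>xs. length xs = n \<and> set xs \<subseteq> S \<union> uminus ` S \<and> sum_list xs = x)"

definition word_dist :: "'g::group_add set \<Rightarrow> 'g \<Rightarrow> 'g \<Rightarrow> real" where
  "word_dist S g h = real (word_length S (- g + h))"

text \<open>L_p(Omega,mu) over real scalars: p-integrable functions, modulo the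
null seminorm (all statements below only use norms of differences).\<close>
definition Lp_set :: "real \<Rightarrow> 'v measure \<Rightarrow> ('v \<Rightarrow> real) set" where
  "Lp_set p M = {u. u \<in> borel_measurable M \<and> integrable M (\<lambda>x. \<bar>u x\<bar> powr p)}"

definition Lp_norm :: "real \<Rightarrow> 'v measure \<Rightarrow> ('v \<Rightarrow> real) \<Rightarrow> real" where
  "Lp_norm p M u = (\<integral>x. \<bar>u x\<bar> powr p \<partial>M) powr (1 / p)"

definition Lp_dist :: "real \<Rightarrow> 'v measure \<Rightarrow> ('v \<Rightarrow> real) \<Rightarrow> ('v \<Rightarrow> real) \<Rightarrow> real" where
  "Lp_dist p M u v = Lp_norm p M (\<lambda>x. u x - v x)"

text \<open>continuous affine isometric action of G on L_p(M) (equalities in L_p are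
equalities up to null functions, i.e. Lp_dist = 0)\<close>
definition affine_isometric_action ::
  "real \<Rightarrow> 'v measure \<Rightarrow> ('g::{topological_space,group_add} \<Rightarrow> ('v \<Rightarrow> real) \<Rightarrow> ('v \<Rightarrow> real)) \<Rightarrow> bool" where
  "affine_isometric_action p M \<alpha> \<longleftrightarrow>
     (\<forall>g. \<forall>u\<in>Lp_set p M. \<alpha> g u \<in> Lp_set p M) \<and>
     (\<forall>g. \<forall>u\<in>Lp_set p M. \<forall>v\<in>Lp_set p M. Lp_dist p M (\<alpha> g u) (\<alpha> g v) = Lp_dist p M u v) \<and>
     (\<forall>g. \<forall>u\<in>Lp_set p M. \<forall>v\<in>Lp_set p M. \<forall>t::real.
        Lp_dist p M (\<alpha> g (\<lambda>x. t * u x + (1 - t) * v x))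
                    (\<lambda>x. t * \<alpha> g u x + (1 - t) * \<alpha> g v x) = 0) \<and>
     (\<forall>u\<in>Lp_set p M. Lp_dist p M (\<alpha> 0 u) u = 0) \<and>
     (\<forall>g h. \<forall>u\<in>Lp_set p M. Lp_dist p M (\<alpha> (g + h) u) (\<alpha> g (\<alpha> h u)) = 0) \<and>
     (\<forall>u\<in>Lp_set p M. \<forall>g0. \<forall>e>0. \<exists>U. open U \<and> g0 \<in> U \<and>
        (\<forall>g\<in>U. Lp_dist p M (\<alpha> g u) (\<alpha> g0 u) < e))"

definition equivariant ::
  "real \<Rightarrow> 'v measure \<Rightarrow> ('g::{topological_space,group_add} \<Rightarrow> ('v \<Rightarrow> real)) \<Rightarrow> bool" where
  "equivariant p M f \<longleftrightarrow> (\<forall>g. f g \<in> Lp_set p M) \<and>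
     (\<exists>\<alpha>. affine_isometric_action p M \<alpha> \<and>
        (\<forall>g h. Lp_dist p M (f (g + h)) (\<alpha> g (f h)) = 0))"

definition coarse_embedding ::
  "real \<Rightarrow> 'v measure \<Rightarrow> 'g::group_add set \<Rightarrow> ('g \<Rightarrow> ('v \<Rightarrow> real)) \<Rightarrow> bool" where
  "coarse_embedding p M S f \<longleftrightarrow> (\<forall>g. f g \<in> Lp_set p M) \<and>
     (\<exists>\<rho>::real \<Rightarrow> real. \<exists>C>0. mono_on {0..} \<rho> \<and> (\<forall>t\<ge>0. \<rho> t \<ge> 0) \<and>
        filterlim \<rho> at_top at_top \<and>
        (\<forall>g h. \<rho> (word_dist S g h) \<le> Lp_dist p M (f g) (f h) \<and>
               Lp_dist p M (f g) (f h) \<le> C * word_dist S g h))"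

definition compression ::
  "real \<Rightarrow> 'v measure \<Rightarrow> 'g::group_add set \<Rightarrow> ('g \<Rightarrow> ('v \<Rightarrow> real)) \<Rightarrow> real" where
  "compression p M S f = Sup {r. 0 \<le> r \<and> r \<le> 1 \<and> (\<exists>C>0. \<exists>D>0. \<forall>g h.
        (word_dist S g h) powr r / C - D \<le> Lp_dist p M (f g) (f h) \<and>
        Lp_dist p M (f g) (f h) \<le> C * word_dist S g h)}"

text \<open>equivariant L_p compression, with measure spaces ranging over the type 'v
(HOL cannot quantify over all types inside a term)\<close>
definition equiv_compression ::
  "real \<Rightarrow> 'v itself \<Rightarrow> 'g::{topological_space,group_add} set \<Rightarrow> real" where
  "equiv_compression p (_::'v itself) S = Sup ({0} \<union>
     {compression p M S f | (M::'v measure) f. equivariant p M f \<and> coarse_embedding p M S f})"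

end

theory Submission
  imports Defs
begin

text \<open>An affine isometric action on a Hilbert space \<open>H = L_2(M)\<close> is carried to \<open>L_p\<close> by the
Gaussian functor. Let \<open>\<gamma>\<close> be the law of the centered Gaussian process indexed by \<open>H\<close> whose covariance
is the inner product. Since \<open>\<gamma>\<close> is determined by the covariance, every orthogonal map \<open>T\<close> of \<open>H\<close>
preserves \<open>\<gamma>\<close> when it acts on the sample space by \<open>\<omega> \<mapsto> \<omega> \<circ> T\<close>, and so acts isometrically on
\<open>L_p(\<gamma>)\<close>. Writing the given action as \<open>u \<mapsto> T\<^sub>g u + b\<^sub>g\<close>, the formula
\<open>F \<mapsto> F(\<omega> \<circ> T\<^sub>g) + \<omega>(b\<^sub>g)\<close> defines an affine isometric action on \<open>L_p(\<gamma>)\<close> for which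
\<open>g \<mapsto> (\<omega> \<mapsto> \<omega>(f g))\<close> is equivariant. As \<open>\<omega>(u) - \<omega>(v)\<close> is Gaussian with standard deviation
\<open>\<parallel>u - v\<parallel>\<close>, the new map has the same compression as \<open>f\<close>, up to a constant factor in the distances.\<close>

section \<open>Uniqueness of laws on product spaces\<close>

text \<open>Gaussian variables serve every \<open>p\<close> at once, because the \<open>L_p\<close>
  norm of a centered Gaussian is its standard deviation times a constant depending on
  \<open>p\<close> alone. The obstacle is that \<open>L_2(M)\<close> may be nonseparable, so the
  process has an uncountable index set. A sample point is an arbitrary function, not a linear
  functional: additivity of \<omega>, and the composition law of the maps
  \<open>\<omega> \<mapsto> \<omega> \<circ> T_g\<close>, hold only almost surely for each fixed
  index, with an exceptional set that depends on the index. Two facts must therefore be carried from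
  single coordinates to arbitrary \<open>F\<close> in \<open>L_p(\<gamma>)\<close>: almost sure
  equality, and convergence in probability as \<open>g\<close> tends to \<open>g0\<close>. Both
  follow from one approximation result (\<open>Lp_convergence\<close>), whose engine is that all
  maps involved preserve \<gamma>. It is stated for filters because the topology of the group need
  not be first countable.\<close>

text \<open>Normalizing the weight \<open>w\<close> to a density makes this Levy uniqueness for the
  law of \<open>X\<close> under the tilted measure. The phase \<open>c\<close> supplies both parts
  of the characteristic function: \<open>c = 0\<close> the real part, \<open>c = - pi / 2\<close>
  the imaginary part.\<close>

lemma measure_eq_of_trig_integrals:
  fixes X w :: "'a \<Rightarrow> real"
  assumes "prob_space \<mu>" "prob_space \<nu>" and sets: "sets \<nu> = sets \<mu>"
    and X [measurable]: "X \<in> borel_measurable \<mu>" and w [measurable]: "w \<in> borel_measurable \<mu>"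
    and w_bd: "\<And>x. 0 \<le> w x" "\<And>x. w x \<le> B"
    and trig: "\<And>s c. (\<integral>x. w x * cos (s * X x + c) \<partial>\<mu>) = (\<integral>x. w x * cos (s * X x + c) \<partial>\<nu>)"
    and A [measurable]: "A \<in> sets borel"
  shows "(\<integral>x. w x * indicator A (X x) \<partial>\<mu>) = (\<integral>x. w x * indicator A (X x) \<partial>\<nu>)"
proof -
  define m where "m = (\<integral>x. w x \<partial>\<mu>)"
  have m': "m = (\<integral>x. w x \<partial>\<nu>)"
    using trig[of 0 0] by (simp add: m_def)
  have step: "real_distribution (distr (density \<rho> (\<lambda>x. ennreal (w x / m))) borel X)"
    "char (distr (density \<rho> (\<lambda>x. ennreal (w x / m))) borel X) t =
       Complex ((\<integral>x. w x * cos (t * X x + 0) \<partial>\<rho>) / m) ((\<integral>x. w x * cos (t * X x + (- pi / 2)) \<partial>\<rho>) / m)"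
    "measure (distr (density \<rho> (\<lambda>x. ennreal (w x / m))) borel X) A = (\<integral>x. w x * indicator A (X x) \<partial>\<rho>) / m"
    if \<rho>: "prob_space \<rho>" "sets \<rho> = sets \<mu>" "m = (\<integral>x. w x \<partial>\<rho>)" "m > 0" for \<rho> t
  proof -
    interpret prob_space \<rho> by fact
    note \<rho>(2)[measurable_cong]
    have int: "integrable \<rho> (\<lambda>x. w x * f x)"
      if [measurable]: "f \<in> borel_measurable \<rho>" and "\<And>x. \<bar>f x\<bar> \<le> 1" for f
      using w_bd that(2) by (intro integrable_const_bound[where B = B]) (auto simp: abs_mult mult_le_one intro!: AE_I2 order.trans[OF mult_left_le])
    have int0: "integrable \<rho> w" using int[of "\<lambda>_. 1"] by simp
    have "emeasure (density \<rho> (\<lambda>x. ennreal (w x / m))) (space \<rho>) = (\<integral>\<^sup>+x. ennreal (w x / m) \<partial>\<rho>)"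
      by (subst emeasure_density) (auto intro!: nn_integral_cong)
    also have "\<dots> = ennreal (\<integral>x. w x / m \<partial>\<rho>)"
      using int0 w_bd(1) \<rho>(4) by (intro nn_integral_eq_integral) auto
    also have "\<dots> = 1" using \<rho>(3,4) by simp
    finally have D: "prob_space (density \<rho> (\<lambda>x. ennreal (w x / m)))"
      by (intro prob_spaceI) simp
    show "real_distribution (distr (density \<rho> (\<lambda>x. ennreal (w x / m))) borel X)"
      by (intro prob_space.real_distribution_distr D) simp
    have "char (distr (density \<rho> (\<lambda>x. ennreal (w x / m))) borel X) t
        = (CLINT x|\<rho>. (w x / m) *\<^sub>R iexp (t * X x))"
      using w_bd(1) \<rho>(4) unfolding char_def by (simp add: integral_distr integral_density)
    also have "\<dots> = Complex (\<integral>x. w x * cos (t * X x) / m \<partial>\<rho>) (\<integral>x. w x * sin (t * X x) / m \<partial>\<rho>)"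
    proof -
      have i: "integrable \<rho> (\<lambda>x. (w x / m) *\<^sub>R iexp (t * X x))"
        using w_bd \<rho>(4) by (intro integrable_const_bound[where B = "B / m"]) (auto simp: divide_right_mono)
      show ?thesis
        by (rule complex_eqI; subst integral_Re[OF i, symmetric] integral_Im[OF i, symmetric])
          (simp_all add: Re_exp Im_exp)
    qed
    finally show "char (distr (density \<rho> (\<lambda>x. ennreal (w x / m))) borel X) t =
       Complex ((\<integral>x. w x * cos (t * X x + 0) \<partial>\<rho>) / m) ((\<integral>x. w x * cos (t * X x + (- pi / 2)) \<partial>\<rho>) / m)"
      by (simp add: cos_diff)
    have "measure (distr (density \<rho> (\<lambda>x. ennreal (w x / m))) borel X) A
        = (\<integral>x. indicator A x \<partial>(distr (density \<rho> (\<lambda>x. ennreal (w x / m))) borel X))"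
      by simp
    also have "\<dots> = (\<integral>x. w x / m * indicator A (X x) \<partial>\<rho>)"
      using w_bd(1) \<rho>(4) by (subst integral_distr) (auto simp: integral_density)
    finally show "measure (distr (density \<rho> (\<lambda>x. ennreal (w x / m))) borel X) A = (\<integral>x. w x * indicator A (X x) \<partial>\<rho>) / m"
      by simp
  qed
  show ?thesis
  \<comment> \<open>A weight of total mass 0 cannot be normalized, but being nonnegative it then
    vanishes almost everywhere for both measures.\<close>
  proof (cases "m = 0")
    case True
    have "(\<integral>x. w x * indicator A (X x) \<partial>\<rho>) = 0"
      if \<rho>: "prob_space \<rho>" "sets \<rho> = sets \<mu>" "m = (\<integral>x. w x \<partial>\<rho>)" for \<rho>
    proof -
      interpret prob_space \<rho> by fact
      note \<rho>(2)[measurable_cong]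
      have "integrable \<rho> w"
        using w_bd by (intro integrable_const_bound[where B = B]) auto
      then have "AE x in \<rho>. w x = 0"
        using integral_nonneg_eq_0_iff_AE[of \<rho> w] w_bd(1) \<rho>(3) True by auto
      then show ?thesis by (intro integral_eq_zero_AE) auto
    qed
    from this[OF \<open>prob_space \<mu>\<close> refl m_def] this[OF \<open>prob_space \<nu>\<close> sets m'] show ?thesis by simp
  next
    case False
    moreover have "m \<ge> 0" unfolding m_def using w_bd(1) by simp
    ultimately have m: "m > 0" by simp
    note 1 = step[OF \<open>prob_space \<mu>\<close> refl m_def m] and 2 = step[OF \<open>prob_space \<nu>\<close> sets m' m]
    have "distr (density \<mu> (\<lambda>x. ennreal (w x / m))) borel X = distr (density \<nu> (\<lambda>x. ennreal (w x / m))) borel X"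
      by (rule Levy_uniqueness[OF 1(1) 2(1)]) (simp only: fun_eq_iff 1(2) 2(2) trig simp_thms)
    with 1(3) 2(3) m show ?thesis by simp
  qed
qed

text \<open>One factor \<open>indicator (A a) (X a x)\<close> is added at a time, applying the one-dimensional uniqueness
theorem under the weight \<open>P x * (1 + cos (l x))\<close>, which is nonnegative unlike \<open>P x * cos (l x)\<close>. The
constants in \<open>V\<close> make cosines suffice, sine being a shifted cosine.\<close>

lemma integral_prod_indicator_eq_of_cos_integrals:
  fixes V :: "('a \<Rightarrow> real) set"
  assumes "prob_space \<mu>" "prob_space \<nu>" and sets: "sets \<nu> = sets \<mu>"
    and V_meas: "\<And>l. l \<in> V \<Longrightarrow> l \<in> borel_measurable \<mu>"
    and V_const: "\<And>c. (\<lambda>_. c) \<in> V"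
    and V_add: "\<And>l l'. l \<in> V \<Longrightarrow> l' \<in> V \<Longrightarrow> (\<lambda>x. l x + l' x) \<in> V"
    and V_scale: "\<And>l s. l \<in> V \<Longrightarrow> (\<lambda>x. s * l x) \<in> V"
    and cos_eq: "\<And>l. l \<in> V \<Longrightarrow> (\<integral>x. cos (l x) \<partial>\<mu>) = (\<integral>x. cos (l x) \<partial>\<nu>)"
    and J: "finite J" and X: "\<And>j. j \<in> J \<Longrightarrow> X j \<in> V" and A: "\<And>j. j \<in> J \<Longrightarrow> A j \<in> sets borel"
    and "l \<in> V"
  shows "(\<integral>x. (\<Prod>j\<in>J. indicator (A j) (X j x)) * cos (l x) \<partial>\<mu>) =
         (\<integral>x. (\<Prod>j\<in>J. indicator (A j) (X j x)) * cos (l x) \<partial>\<nu>)"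
  using J X A \<open>l \<in> V\<close>
proof (induction J arbitrary: l)
  case empty
  then show ?case by (simp add: cos_eq)
next
  case (insert a J)
  interpret \<mu>: prob_space \<mu> by fact
  interpret \<nu>: prob_space \<nu> by fact
  note sets[measurable_cong]
  have Xa: "X a \<in> V" and [measurable]: "A a \<in> sets borel" "l \<in> borel_measurable \<mu>"
    using insert.prems V_meas by auto
  have [measurable]: "X j \<in> borel_measurable \<mu>" "A j \<in> sets borel" if "j \<in> insert a J" for j
    using insert.prems V_meas that by auto
  define P where "P = (\<lambda>x. \<Prod>j\<in>J. indicator (A j) (X j x) :: real)"
  have [measurable]: "P \<in> borel_measurable \<mu>" "X a \<in> borel_measurable \<mu>" unfolding P_def by measurable
  have P_bd: "0 \<le> P x" "P x \<le> 1" for x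
    unfolding P_def by (auto intro!: prod_nonneg prod_le_1)
  have IH: "(\<integral>x. P x * cos (l x) \<partial>\<mu>) = (\<integral>x. P x * cos (l x) \<partial>\<nu>)" if "l \<in> V" for l
    unfolding P_def using insert that by auto
  have int: "integrable \<rho> (\<lambda>x. P x * f x)"
    if "prob_space \<rho>" "sets \<rho> = sets \<mu>" and f: "f \<in> borel_measurable \<mu>" and "\<And>x. \<bar>f x\<bar> \<le> 1" for f \<rho>
  proof -
    interpret prob_space \<rho> by fact
    note \<open>sets \<rho> = sets \<mu>\<close>[measurable_cong] f[measurable]
    show ?thesis using P_bd that(4)
      by (intro integrable_const_bound[where B = 1]) (auto simp: abs_mult intro!: AE_I2 mult_le_one)
  qed
  have key: "(\<integral>x. (P x * (1 + cos (l x))) * indicator (A a) (X a x) \<partial>\<mu>) = (\<integral>x. (P x * (1 + cos (l x))) * indicator (A a) (X a x) \<partial>\<nu>)"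
    if "l \<in> V" for l
  proof (rule measure_eq_of_trig_integrals[OF assms(1-3), where B = 2])
    have [measurable]: "l \<in> borel_measurable \<mu>" using that V_meas by auto
    show "(\<lambda>x. P x * (1 + cos (l x))) \<in> borel_measurable \<mu>" by measurable
    show "0 \<le> P x * (1 + cos (l x))" for x
      using P_bd(1)[of x] cos_ge_minus_one[of "l x"] by (intro mult_nonneg_nonneg) linarith+
    show "P x * (1 + cos (l x)) \<le> 2" for x
      using mult_mono[OF P_bd(2)[of x], of "1 + cos (l x)" 2] cos_le_one[of "l x"] cos_ge_minus_one[of "l x"] by auto
    fix s c :: real
    \<comment> \<open>The product-to-sum formula leaves only integrals of \<open>P\<close> times one
      cosine, whose arguments lie again in \<open>V\<close>, so the induction hypothesis covers each
      of them.\<close>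
    have *: "(\<integral>x. P x * (1 + cos (l x)) * cos (s * X a x + c) \<partial>\<rho>) =
      (\<integral>x. P x * cos (s * X a x + c) \<partial>\<rho>) + ((\<integral>x. P x * cos (l x + (s * X a x + c)) \<partial>\<rho>)
        + (\<integral>x. P x * cos (l x + (-1) * (s * X a x + c)) \<partial>\<rho>)) / 2"
      if "prob_space \<rho>" "sets \<rho> = sets \<mu>" for \<rho>
    proof -
      have "P x * (1 + cos (l x)) * cos (s * X a x + c) =
        P x * cos (s * X a x + c) + (P x * cos (l x + (s * X a x + c)) + P x * cos (l x + (-1) * (s * X a x + c))) / 2" for x
        unfolding mult_minus1 by (simp only: cos_add cos_minus sin_minus) (simp add: field_simps)
      then show ?thesis
        using int[OF that] by simp
    qed
    have "(\<lambda>x. s * X a x + c) \<in> V" using V_add[OF V_scale[OF Xa] V_const] .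
    then show "(\<integral>x. P x * (1 + cos (l x)) * cos (s * X a x + c) \<partial>\<mu>) = (\<integral>x. P x * (1 + cos (l x)) * cos (s * X a x + c) \<partial>\<nu>)"
      using *[OF assms(1) refl] *[OF assms(2) sets] IH V_add[OF \<open>l \<in> V\<close>] V_scale by presburger
  qed simp_all
  have split: "(\<integral>x. (P x * (1 + cos (l x))) * indicator (A a) (X a x) \<partial>\<rho>) =
      (\<integral>x. P x * indicator (A a) (X a x) \<partial>\<rho>) + (\<integral>x. P x * (indicator (A a) (X a x) * cos (l x)) \<partial>\<rho>)"
    if "prob_space \<rho>" "sets \<rho> = sets \<mu>" for \<rho>
  proof -
    have "P x * (1 + cos (l x)) * indicator (A a) (X a x) = P x * indicator (A a) (X a x) + P x * (indicator (A a) (X a x) * cos (l x))" for x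
      by (simp add: field_simps)
    moreover have "integrable \<rho> (\<lambda>x. P x * indicator (A a) (X a x))"
      by (intro int that) (auto simp: indicator_def)
    moreover have "integrable \<rho> (\<lambda>x. P x * (indicator (A a) (X a x) * cos (l x)))"
      by (intro int that) (auto simp: indicator_def)
    ultimately show ?thesis by simp
  qed
  \<comment> \<open>For the constant function \<open>l = 0\<close> the weight is
    \<open>2 * P\<close>. This settles the term without a cosine, and subtracting it from
    \<open>key\<close> isolates the term with \<open>cos (l x)\<close>.\<close>
  have "(\<integral>x. P x * indicator (A a) (X a x) \<partial>\<mu>) = (\<integral>x. P x * indicator (A a) (X a x) \<partial>\<nu>)"
  proof -
    have "(\<integral>x. (P x * (1 + cos 0)) * indicator (A a) (X a x) \<partial>\<rho>) = 2 * (\<integral>x. P x * indicator (A a) (X a x) \<partial>\<rho>)" for \<rho>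
      by (subst Bochner_Integration.integral_mult_right_zero[symmetric])
        (auto intro!: Bochner_Integration.integral_cong simp: field_simps)
    then show ?thesis using key[OF V_const[of 0]] by simp
  qed
  then have "(\<integral>x. P x * (indicator (A a) (X a x) * cos (l x)) \<partial>\<mu>) = (\<integral>x. P x * (indicator (A a) (X a x) * cos (l x)) \<partial>\<nu>)"
    using key[of l] split[OF assms(1) refl] split[OF assms(2) sets] insert.prems(3) by simp
  then show ?case
    using insert.hyps by (simp add: P_def mult_ac)
qed

text \<open>A finite linear combination is given by its list of coefficient-index pairs, so that sums of
combinations are appended lists and repeated indices need no care.\<close>

definition lincomb :: "(real \<times> 'i) list \<Rightarrow> ('i \<Rightarrow> real) \<Rightarrow> real" where
  "lincomb xs \<omega> = (\<Sum>(t, i)\<leftarrow>xs. t * \<omega> i)"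

lemma lincomb_simps [simp]:
  "lincomb [] \<omega> = 0"
  "lincomb ((t, i) # xs) \<omega> = t * \<omega> i + lincomb xs \<omega>"
  "lincomb (xs @ ys) \<omega> = lincomb xs \<omega> + lincomb ys \<omega>"
  by (simp_all add: lincomb_def)

lemma lincomb_linear:
  "lincomb xs (\<lambda>i. \<omega> i + \<eta> i) = lincomb xs \<omega> + lincomb xs \<eta>"
  "lincomb xs (\<lambda>i. \<omega> i - \<eta> i) = lincomb xs \<omega> - lincomb xs \<eta>"
  "lincomb xs (\<lambda>i. s * \<omega> i) = s * lincomb xs \<omega>"
  "lincomb xs (\<lambda>i. \<omega> i * s) = lincomb xs \<omega> * s"
  "lincomb xs (\<lambda>i. \<omega> i / s) = lincomb xs \<omega> / s"
  by (induction xs) (auto simp: algebra_simps add_divide_distrib)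

lemma lincomb_map_scale: "lincomb (map (map_prod ((*) s) f) xs) \<omega> = s * lincomb xs (\<lambda>i. \<omega> (f i))"
  by (induction xs) (auto simp: algebra_simps)

lemma lincomb_cong:
  "(\<And>i. i \<in> snd ` set xs \<Longrightarrow> \<omega> i = \<eta> i) \<Longrightarrow> lincomb xs \<omega> = lincomb xs \<eta>"
  by (induction xs) force+

lemma lincomb_measurable:
  "(\<And>i. i \<in> snd ` set xs \<Longrightarrow> (\<lambda>x. f x i) \<in> borel_measurable M) \<Longrightarrow> (\<lambda>x. lincomb xs (f x)) \<in> borel_measurable M"
proof (induction xs)
  case (Cons p xs)
  obtain t i where [simp]: "p = (t, i)" by (cases p)
  have [measurable]: "(\<lambda>x. f x i) \<in> borel_measurable M" "(\<lambda>x. lincomb xs (f x)) \<in> borel_measurable M"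
    using Cons by auto
  show ?case by simp
qed simp

text \<open>Cylinder sets determine a measure on the product, and their probabilities are integrals
  of products of indicators. These reduce to cosine integrals of affine functions of finitely many
  coordinates, which depend only on the laws of the linear combinations.\<close>

lemma Cramer_Wold_PiM:
  assumes "prob_space \<mu>" "prob_space \<nu>"
    and s\<mu>: "sets \<mu> = sets (PiM I (\<lambda>_. borel :: real measure))" and s\<nu>: "sets \<nu> = sets (PiM I (\<lambda>_. borel))"
    and eq: "\<And>xs. snd ` set xs \<subseteq> I \<Longrightarrow> distr \<mu> borel (lincomb xs) = distr \<nu> borel (lincomb xs)"
  shows "\<mu> = \<nu>"
proof (rule measure_eqI_PiM_infinite[OF s\<mu> s\<nu>])
  interpret \<mu>: prob_space \<mu> by fact
  interpret \<nu>: prob_space \<nu> by fact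
  show "finite_measure \<mu>" by (rule \<mu>.finite_measure_axioms)
  note s\<mu>[measurable_cong] s\<nu>[measurable_cong]
  have meas: "lincomb xs \<in> borel_measurable \<mu>" "lincomb xs \<in> borel_measurable \<nu>" if "snd ` set xs \<subseteq> I" for xs
    using that by (auto intro!: lincomb_measurable[where f = "\<lambda>\<omega>. \<omega>"] measurable_component_singleton
        simp: measurable_cong_sets[OF s\<mu> refl] measurable_cong_sets[OF s\<nu> refl])
  fix A J assume J: "finite J" "J \<subseteq> I" and A: "\<And>i. i \<in> J \<Longrightarrow> A i \<in> sets (borel :: real measure)"
  define V where "V = {\<lambda>\<omega>. lincomb xs \<omega> + c | xs c. snd ` set xs \<subseteq> I}"
  have V_cases: thesis if "l \<in> V" "\<And>xs c. l = (\<lambda>\<omega>. lincomb xs \<omega> + c) \<Longrightarrow> snd ` set xs \<subseteq> I \<Longrightarrow> thesis" for l thesis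
    using that unfolding V_def by auto
  have V_I: "(\<lambda>\<omega>. lincomb xs \<omega> + c) \<in> V" if "snd ` set xs \<subseteq> I" for xs c
    using that unfolding V_def by auto
  \<comment> \<open>The factor \<open>cos 0 = 1\<close> brings the cylinder probability into the
    shape of the general lemma with \<open>l = 0\<close>.\<close>
  have "(\<integral>\<omega>. (\<Prod>j\<in>J. indicator (A j) (\<omega> j)) * cos (0::real) \<partial>\<mu>) =
         (\<integral>\<omega>. (\<Prod>j\<in>J. indicator (A j) (\<omega> j)) * cos (0::real) \<partial>\<nu>)"
  proof (rule integral_prod_indicator_eq_of_cos_integrals[OF assms(1,2), where V = V and X = "\<lambda>j \<omega>. \<omega> j" and l = "\<lambda>_. 0"])
    show "sets \<nu> = sets \<mu>" using s\<mu> s\<nu> by simp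
    show "l \<in> borel_measurable \<mu>" if "l \<in> V" for l
      using that meas unfolding V_def by auto
    show const: "(\<lambda>_. c) \<in> V" for c
      using V_I[of "[]" c] by simp
    show "(\<lambda>x. l x + l' x) \<in> V" if "l \<in> V" "l' \<in> V" for l l'
    proof -
      obtain xs c where l: "l = (\<lambda>\<omega>. lincomb xs \<omega> + c)" "snd ` set xs \<subseteq> I"
        using \<open>l \<in> V\<close> by (rule V_cases)
      obtain ys d where l': "l' = (\<lambda>\<omega>. lincomb ys \<omega> + d)" "snd ` set ys \<subseteq> I"
        using \<open>l' \<in> V\<close> by (rule V_cases)
      show ?thesis using V_I[of "xs @ ys" "c + d"] l(2) l'(2) by (simp add: l(1) l'(1) image_Un algebra_simps)
    qed
    show "(\<lambda>x. s * l x) \<in> V" if "l \<in> V" for l s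
    proof -
      obtain xs c where l: "l = (\<lambda>\<omega>. lincomb xs \<omega> + c)" "snd ` set xs \<subseteq> I"
        using \<open>l \<in> V\<close> by (rule V_cases)
      have "snd ` set (map (map_prod ((*) s) id) xs) \<subseteq> I" using l(2) by auto
      from V_I[OF this, of "s * c"] show ?thesis
        by (simp add: l(1) lincomb_map_scale algebra_simps)
    qed
    show "(\<integral>x. cos (l x) \<partial>\<mu>) = (\<integral>x. cos (l x) \<partial>\<nu>)" if "l \<in> V" for l
    proof -
      obtain xs c where *: "l = (\<lambda>\<omega>. lincomb xs \<omega> + c)" "snd ` set xs \<subseteq> I"
        using \<open>l \<in> V\<close> by (rule V_cases)
      have "(\<integral>x. cos (l x) \<partial>\<mu>) = (\<integral>y. cos (y + c) \<partial>distr \<mu> borel (lincomb xs))"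
        unfolding * using meas[OF *(2)] by (subst integral_distr) auto
      also have "\<dots> = (\<integral>x. cos (l x) \<partial>\<nu>)"
        unfolding * eq[OF *(2)] using meas[OF *(2)] by (subst integral_distr) auto
      finally show ?thesis .
    qed
    show "(\<lambda>\<omega>. \<omega> j) \<in> V" if "j \<in> J" for j
      using V_I[of "[(1, j)]" 0] that J by auto
    show "(\<lambda>_. 0) \<in> V" by (rule const)
  qed (use J A in auto)
  moreover have "(\<integral>\<omega>. (\<Prod>j\<in>J. indicator (A j) (\<omega> j)) * cos (0::real) \<partial>\<rho>)
     = measure \<rho> (prod_emb I (\<lambda>_. borel) J (Pi\<^sub>E J A))"
    if s: "sets \<rho> = sets (PiM I (\<lambda>_. borel))" for \<rho> :: "('a \<Rightarrow> real) measure"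
  proof -
    have "(\<integral>\<omega>. (\<Prod>j\<in>J. indicator (A j) (\<omega> j)) * cos (0::real) \<partial>\<rho>)
       = (\<integral>\<omega>. indicator (prod_emb I (\<lambda>_. borel) J (Pi\<^sub>E J A)) \<omega> \<partial>\<rho>)"
    proof (intro Bochner_Integration.integral_cong refl)
      fix \<omega> assume "\<omega> \<in> space \<rho>"
      then have "\<omega> \<in> Pi\<^sub>E I (\<lambda>_. UNIV)" using sets_eq_imp_space_eq[OF s] by (simp add: space_PiM)
      then show "(\<Prod>j\<in>J. indicator (A j) (\<omega> j)) * cos 0 = (indicator (prod_emb I (\<lambda>_. borel) J (Pi\<^sub>E J A)) \<omega> :: real)"
        using J(1) by (auto simp: prod_emb_def indicator_def prod_zero_iff PiE_iff)
    qed
    then show ?thesis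
      using sets_PiM_I[OF J, of A "\<lambda>_. borel"] A s sets.sets_into_space by (simp add: Int_absorb2)
  qed
  ultimately show "emeasure \<mu> (prod_emb I (\<lambda>_. borel) J (Pi\<^sub>E J A)) = emeasure \<nu> (prod_emb I (\<lambda>_. borel) J (Pi\<^sub>E J A))"
    using s\<mu> s\<nu> by (simp add: \<mu>.emeasure_eq_measure \<nu>.emeasure_eq_measure)
qed

section \<open>Gaussian processes\<close>

text \<open>The parameter is the variance. Rescaling the standard normal, rather than giving a
  density, includes variance 0 as the point mass at 0.\<close>

definition centered_normal :: "real \<Rightarrow> real measure" where
  "centered_normal q = distr std_normal_distribution borel (\<lambda>x. sqrt q * x)"

lemma real_distribution_centered_normal: "real_distribution (centered_normal q)"
  unfolding centered_normal_def
  by (intro prob_space.real_distribution_distr) (use real_dist_normal_dist in \<open>auto simp: real_distribution_def\<close>)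

lemma char_centered_normal: "q \<ge> 0 \<Longrightarrow> char (centered_normal q) t = exp (- (q * t\<^sup>2) / 2)"
proof -
  assume "q \<ge> 0"
  have "char (centered_normal q) t = char std_normal_distribution (t * sqrt q)"
    unfolding centered_normal_def char_def by (subst integral_distr) (auto simp: mult_ac)
  then show ?thesis using \<open>q \<ge> 0\<close>
    by (simp add: char_std_normal_distribution power_mult_distrib mult_ac)
qed

section \<open>Positive semidefinite kernels and finite Gaussian vectors\<close>

text \<open>The variance of \<open>lincomb xs\<close> under a process with covariance
  \<open>K\<close>.\<close>

definition qform :: "('i \<Rightarrow> 'i \<Rightarrow> real) \<Rightarrow> (real \<times> 'i) list \<Rightarrow> real" where
  "qform K xs = lincomb xs (\<lambda>i. lincomb xs (K i))"

definition psd_kernel :: "('i \<Rightarrow> 'i \<Rightarrow> real) \<Rightarrow> bool" where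
  "psd_kernel K \<longleftrightarrow> (\<forall>i j. K i j = K j i) \<and> (\<forall>xs. 0 \<le> qform K xs)"

text \<open>With \<open>K a a = 0\<close> the form at \<open>t * a + j\<close> is
  \<open>2 * t * K a j + K j j\<close>, affine in \<open>t\<close>, hence unbounded below unless
  \<open>K a j = 0\<close>. The coefficient in the proof makes its value -1.\<close>

lemma psd_kernel_zero_diagonal:
  assumes "psd_kernel K" "K a a = 0"
  shows "K a j = 0"
proof (rule ccontr)
  assume *: "K a j \<noteq> 0"
  have "0 \<le> qform K [(- (K j j + 1) / (2 * K a j), a), (1, j)]" "K j a = K a j"
    using assms unfolding psd_kernel_def by blast+
  then show False
    using * assms(2) by (simp add: qform_def field_simps)
qed

text \<open>This is the covariance of the residuals after regression on coordinate \<open>a\<close>.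
  Its form at \<open>xs\<close> is the value of \<open>K\<close> at \<open>xs\<close> with a
  suitable multiple of \<open>a\<close> adjoined, hence nonnegative. If \<open>K a a = 0\<close>,
  division by zero gives 0 and the kernel is unchanged.\<close>

lemma psd_kernel_Schur_complement:
  assumes K: "psd_kernel K"
  shows "psd_kernel (\<lambda>i j. K i j - K i a * K a j / K a a)"
proof (cases "K a a = 0")
  case True
  then show ?thesis using K by simp
next
  case False
  have sym: "K i j = K j i" for i j using K unfolding psd_kernel_def by blast
  have "0 \<le> qform (\<lambda>i j. K i j - K i a * K a j / K a a) xs" for xs
  proof -
    define s where "s = lincomb xs (K a)"
    have s': "lincomb xs (\<lambda>i. K i a) = s" unfolding s_def by (subst sym) simp
    \<comment> \<open>The regression coefficient: it minimizes the form at
      \<open>(r, a) # xs\<close> over \<open>r\<close>.\<close>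
    define r where "r = - s / K a a"
    have r: "r * K a a = - s" using False by (simp add: r_def)
    have "0 \<le> qform K ((r, a) # xs)"
      using K unfolding psd_kernel_def by blast
    also have "\<dots> = qform K xs + r * s"
      by (simp add: qform_def lincomb_linear s' s_def[symmetric] r)
    also have "\<dots> = qform K xs - s * s / K a a"
      by (simp add: r_def)
    also have "\<dots> = qform (\<lambda>i j. K i j - K i a * K a j / K a a) xs"
      by (simp add: qform_def lincomb_linear s' s_def[symmetric])
    finally show ?thesis .
  qed
  moreover have "K i j - K i a * K a j / K a a = K j i - K j a * K a i / K a a" for i j
    by (subst (1 2 3) sym) simp
  ultimately show ?thesis unfolding psd_kernel_def by blast
qed

text \<open>Cholesky factorization: the Schur complement at \<open>a\<close> removes one index, and
  the rank-one part subtracted from the kernel becomes one more column.\<close>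

lemma psd_kernel_factorization:
  assumes "finite J" "psd_kernel K"
  obtains n :: nat and c :: "'a \<Rightarrow> nat \<Rightarrow> real" where "\<And>i j. i \<in> J \<Longrightarrow> j \<in> J \<Longrightarrow> K i j = (\<Sum>k<n. c i k * c j k)"
proof -
  have "\<exists>(n::nat) c. \<forall>i\<in>J. \<forall>j\<in>J. K i j = (\<Sum>k<n. c i k * c j k)"
    using assms
  proof (induction J arbitrary: K)
    case (insert a J)
    have sym: "K i j = K j i" for i j using insert.prems unfolding psd_kernel_def by blast
    have "0 \<le> qform K [(1, a)]" using insert.prems unfolding psd_kernel_def by blast
    then have nn: "K a a \<ge> 0" by (simp add: qform_def)
    obtain n and c :: "'a \<Rightarrow> nat \<Rightarrow> real" where c: "\<And>i j. i \<in> J \<Longrightarrow> j \<in> J \<Longrightarrow> K i j - K i a * K a j / K a a = (\<Sum>k<n. c i k * c j k)"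
      using insert.IH[OF psd_kernel_Schur_complement[OF insert.prems, of a]] by metis
    \<comment> \<open>Column \<open>n\<close> is the new one, and is zero when
      \<open>K a a = 0\<close>. The induction hypothesis says nothing about index \<open>a\<close>,
      whose old entries are set to 0 because row and column \<open>a\<close> of the complement
      vanish; for \<open>K a a = 0\<close> this needs
      \<open>psd_kernel_zero_diagonal\<close>.\<close>
    define d where "d i k = (if k < n then if i = a then 0 else c i k else K i a / sqrt (K a a))" for i k
    have "K i j = (\<Sum>k<Suc n. d i k * d j k)" if "i \<in> insert a J" "j \<in> insert a J" for i j
    proof -
      have "(\<Sum>k<n. d i k * d j k) = K i j - K i a * K a j / K a a"
      proof (cases "i = a \<or> j = a")
        case True
        have "K i j - K i a * K a j / K a a = 0"
        proof (cases "K a a = 0")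
          case True
          then have "K a j = 0" "K j a = 0" for j
            using psd_kernel_zero_diagonal[OF insert.prems, of a j] sym[of j a] by auto
          with \<open>i = a \<or> j = a\<close> show ?thesis by auto
        next
          case False
          with \<open>i = a \<or> j = a\<close> show ?thesis by auto
        qed
        with True show ?thesis by (auto simp: d_def)
      next
        case False
        then show ?thesis using c[of i j] that by (auto simp: d_def)
      qed
      then show ?thesis using nn sym[of j a] by (simp add: d_def)
    qed
    then show ?case by blast
  qed simp
  then obtain n and c :: "'a \<Rightarrow> nat \<Rightarrow> real" where "\<forall>i\<in>J. \<forall>j\<in>J. K i j = (\<Sum>k<n. c i k * c j k)"
    by (elim exE)
  then show ?thesis by (intro that[of c n]) blast
qed

lemma lincomb_sum: "lincomb xs (\<lambda>i. \<Sum>k\<in>A. f i k) = (\<Sum>k\<in>A. lincomb xs (\<lambda>i. f i k))"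
  by (induction xs) (auto simp: sum.distrib sum_distrib_left)

text \<open>The factor \<open>c\<close> is applied to independent standard normals. As an image
  measure this also covers singular covariances, which have no density. A combination becomes a sum
  of the \<open>d k * \<xi> k\<close>, and by independence its characteristic function is a
  product.\<close>

lemma finite_Gaussian_vector_exists:
  fixes K :: "'i \<Rightarrow> 'i \<Rightarrow> real"
  assumes "finite J" "psd_kernel K"
  obtains P where "prob_space P" "sets P = sets (PiM J (\<lambda>_. borel))"
    "\<And>xs. snd ` set xs \<subseteq> J \<Longrightarrow> distr P borel (lincomb xs) = centered_normal (qform K xs)"
proof -
  obtain n and c :: "'i \<Rightarrow> nat \<Rightarrow> real" where c: "\<And>i j. i \<in> J \<Longrightarrow> j \<in> J \<Longrightarrow> K i j = (\<Sum>k<n. c i k * c j k)"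
    using psd_kernel_factorization[OF assms] by metis
  interpret N: prob_space std_normal_distribution
    using real_dist_normal_dist by (simp add: real_distribution_def)
  interpret Q: product_prob_space "\<lambda>_. std_normal_distribution" "{..<n}" ..
  let ?Q = "PiM {..<n} (\<lambda>_. std_normal_distribution)"
  define X where "X = (\<lambda>\<xi>. \<lambda>i\<in>J. \<Sum>k<n. c i k * \<xi> k)"
  have X [measurable]: "X \<in> ?Q \<rightarrow>\<^sub>M PiM J (\<lambda>_. borel)"
    unfolding X_def by (intro measurable_restrict) measurable
  show ?thesis
  proof
    show "prob_space (distr ?Q (PiM J (\<lambda>_. borel)) X)"
      by (intro Q.prob_space_distr X)
    show "sets (distr ?Q (PiM J (\<lambda>_. borel)) X) = sets (PiM J (\<lambda>_. borel))" by simp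
    fix xs :: "(real \<times> 'i) list" assume xs: "snd ` set xs \<subseteq> J"
    define d where "d k = lincomb xs (\<lambda>i. c i k)" for k
    have lX: "lincomb xs (X \<xi>) = (\<Sum>k<n. d k * \<xi> k)" for \<xi>
    proof -
      have "lincomb xs (X \<xi>) = lincomb xs (\<lambda>i. \<Sum>k<n. c i k * \<xi> k)"
        using xs by (intro lincomb_cong) (auto simp: X_def)
      then show ?thesis by (simp add: lincomb_sum lincomb_linear d_def)
    qed
    have q: "qform K xs = (\<Sum>k<n. d k * d k)"
    proof -
      have "qform K xs = lincomb xs (\<lambda>i. lincomb xs (\<lambda>j. \<Sum>k<n. c i k * c j k))"
        unfolding qform_def using xs c by (intro lincomb_cong) blast
      then show ?thesis by (simp add: lincomb_sum lincomb_linear d_def)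
    qed
    have l [measurable]: "lincomb xs \<in> PiM J (\<lambda>_. borel) \<rightarrow>\<^sub>M borel"
      using xs by (intro lincomb_measurable measurable_component_singleton) auto
    have "distr (distr ?Q (PiM J (\<lambda>_. borel)) X) borel (lincomb xs) = distr ?Q borel (\<lambda>\<xi>. \<Sum>k<n. d k * \<xi> k)"
      by (subst distr_distr) (auto simp: comp_def lX)
    also have "\<dots> = centered_normal (qform K xs)"
    proof (rule Levy_uniqueness[OF _ real_distribution_centered_normal], safe intro!: ext)
      show "real_distribution (distr ?Q borel (\<lambda>\<xi>. \<Sum>k<n. d k * \<xi> k))"
        by (intro Q.real_distribution_distr) measurable
      fix t
      have "char (distr ?Q borel (\<lambda>\<xi>. \<Sum>k<n. d k * \<xi> k)) t = (CLINT \<xi>|?Q. (\<Prod>k<n. iexp (t * d k * \<xi> k)))"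
        unfolding char_def
        by (subst integral_distr) (auto simp: exp_sum[symmetric] sum_distrib_left mult_ac)
      also have "\<dots> = (\<Prod>k<n. char std_normal_distribution (t * d k))"
        unfolding char_def
        by (subst Q.product_integral_prod) (auto intro!: N.integrable_const_bound[where B = 1])
      also have "\<dots> = exp (- (qform K xs * t\<^sup>2) / 2)"
      proof -
        have "(\<Sum>k<n. - (t * d k)\<^sup>2 / 2) = - (qform K xs * t\<^sup>2) / 2"
          unfolding q sum_distrib_right sum_negf[symmetric] sum_divide_distrib
          by (intro sum.cong) (auto simp: power2_eq_square)
        then show ?thesis
          by (simp add: char_std_normal_distribution exp_sum[symmetric] flip: of_real_prod)
      qed
      also have "\<dots> = char (centered_normal (qform K xs)) t"
        by (subst char_centered_normal) (auto simp: q intro!: sum_nonneg)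
      finally show "char (distr ?Q borel (\<lambda>\<xi>. \<Sum>k<n. d k * \<xi> k)) t = char (centered_normal (qform K xs)) t" .
    qed
    finally show "distr (distr ?Q (PiM J (\<lambda>_. borel)) X) borel (lincomb xs) = centered_normal (qform K xs)" .
  qed
qed

section \<open>Gaussian fields on infinite index sets\<close>

text \<open>The laws of finite combinations replace the finite-dimensional distributions; by
  \<open>Cramer_Wold_PiM\<close> they determine \<gamma>.\<close>

definition Gaussian_field :: "('i \<Rightarrow> 'i \<Rightarrow> real) \<Rightarrow> ('i \<Rightarrow> real) measure \<Rightarrow> bool" where
  "Gaussian_field K \<gamma> \<longleftrightarrow> prob_space \<gamma> \<and> sets \<gamma> = sets (PiM UNIV (\<lambda>_. borel)) \<and>
     (\<forall>xs. distr \<gamma> borel (lincomb xs) = centered_normal (qform K xs))"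

text \<open>Kolmogorov extension, available because the coordinates take values in a Polish space.
  Consistency of the finite laws is an instance of uniqueness: restriction does not change the law
  of a combination of the remaining coordinates.\<close>

theorem Gaussian_field_exists:
  fixes K :: "'i \<Rightarrow> 'i \<Rightarrow> real"
  assumes K: "psd_kernel K"
  obtains \<gamma> where "Gaussian_field K \<gamma>"
proof -
  \<comment> \<open>Finiteness is a premise inside the existential so that a single choice function
    \<open>P\<close> on all index sets results.\<close>
  have "\<exists>P. finite J \<longrightarrow> prob_space P \<and> sets P = sets (PiM J (\<lambda>_. borel)) \<and>
    (\<forall>xs. snd ` set xs \<subseteq> J \<longrightarrow> distr P borel (lincomb xs) = centered_normal (qform K xs))" for J
    using finite_Gaussian_vector_exists[OF _ K, of J] by metis
  then obtain P where law: "\<And>J. finite J \<Longrightarrow> prob_space (P J)"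
      "\<And>J. finite J \<Longrightarrow> sets (P J) = sets (PiM J (\<lambda>_. borel))"
      "\<And>J xs. finite J \<Longrightarrow> snd ` set xs \<subseteq> J \<Longrightarrow> distr (P J) borel (lincomb xs) = centered_normal (qform K xs)"
    by metis
  have l_meas: "lincomb xs \<in> PiM J (\<lambda>_. borel) \<rightarrow>\<^sub>M borel" if "snd ` set xs \<subseteq> J" for xs :: "(real \<times> 'i) list" and J
    using that by (intro lincomb_measurable measurable_component_singleton) auto
  have consistent: "P J = distr (P H) (PiM J (\<lambda>_. borel)) (\<lambda>f. restrict f J)" if JH: "J \<subseteq> H" "finite H" for J H
  proof (rule Cramer_Wold_PiM)
    have J: "finite J" using JH finite_subset by blast
    have r: "(\<lambda>f. restrict f J) \<in> P H \<rightarrow>\<^sub>M PiM J (\<lambda>_. borel)"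
      using measurable_restrict_subset[OF JH(1)] by (simp add: measurable_cong_sets[OF law(2)[OF JH(2)] refl])
    show "prob_space (P J)" "sets (P J) = sets (PiM J (\<lambda>_. borel))" using law J by auto
    show "prob_space (distr (P H) (PiM J (\<lambda>_. borel)) (\<lambda>f. restrict f J))"
      by (intro prob_space.prob_space_distr law r JH)
    show "sets (distr (P H) (PiM J (\<lambda>_. borel)) (\<lambda>f. restrict f J)) = sets (PiM J (\<lambda>_. borel))" by simp
    fix xs :: "(real \<times> 'i) list" assume xs: "snd ` set xs \<subseteq> J"
    have "distr (distr (P H) (PiM J (\<lambda>_. borel)) (\<lambda>f. restrict f J)) borel (lincomb xs)
       = distr (P H) borel (\<lambda>f. lincomb xs (restrict f J))"
      by (subst distr_distr[OF l_meas[OF xs] r]) (simp add: comp_def)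
    also have "(\<lambda>f. lincomb xs (restrict f J)) = lincomb xs"
      using xs by (intro ext lincomb_cong) auto
    finally show "distr (P J) borel (lincomb xs) = distr (distr (P H) (PiM J (\<lambda>_. borel)) (\<lambda>f. restrict f J)) borel (lincomb xs)"
      using law(3)[OF J xs] law(3)[OF JH(2) order.trans[OF xs JH(1)]] by (simp only:)
  qed
  have "projective_family UNIV P (\<lambda>_. borel)"
    by (rule projective_family.intro) (rule consistent law(1); assumption)+
  then interpret polish_projective UNIV P
    by (rule polish_projective.intro)
  have sets_lim': "sets lim = sets (PiM UNIV (\<lambda>_. borel))" by simp
  have "distr lim borel (lincomb xs) = centered_normal (qform K xs)" for xs
  proof -
    define J where "J = snd ` set xs"
    have J: "finite J" "snd ` set xs \<subseteq> J" by (auto simp: J_def)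
    have r: "(\<lambda>f. restrict f J) \<in> lim \<rightarrow>\<^sub>M PiM J (\<lambda>_. borel)"
      using measurable_restrict_subset[of J UNIV] by (simp add: measurable_cong_sets[OF sets_lim' refl])
    have "distr lim (PiM J (\<lambda>_. borel)) (\<lambda>f. restrict f J) = P J"
    proof (rule measure_eqI)
      fix A assume "A \<in> sets (distr lim (PiM J (\<lambda>_. borel)) (\<lambda>f. restrict f J))"
      then have A: "A \<in> sets (PiM J (\<lambda>_. borel))" by simp
      show "emeasure (distr lim (PiM J (\<lambda>_. borel)) (\<lambda>f. restrict f J)) A = emeasure (P J) A"
        using emeasure_lim_emb[OF subset_UNIV J(1) A] emeasure_distr[OF r A]
        by (simp add: prod_emb_def space_PiM)
    qed (use law(2) J in simp)
    then have "centered_normal (qform K xs) = distr (distr lim (PiM J (\<lambda>_. borel)) (\<lambda>f. restrict f J)) borel (lincomb xs)"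
      using law(3)[OF J] by simp
    also have "\<dots> = distr lim borel (\<lambda>f. lincomb xs (restrict f J))"
      by (subst distr_distr[OF l_meas[OF J(2)] r]) (simp add: comp_def)
    also have "(\<lambda>f. lincomb xs (restrict f J)) = lincomb xs"
      using J by (intro ext lincomb_cong) auto
    finally show ?thesis by simp
  qed
  then show ?thesis
    using that P.prob_space_axioms sets_lim' unfolding Gaussian_field_def by blast
qed

lemma Gaussian_field_coordinate_change:
  assumes \<gamma>: "Gaussian_field K \<gamma>" and T: "\<And>i j. K (T i) (T j) = K i j"
  shows "(\<lambda>\<omega>. \<omega> \<circ> T) \<in> \<gamma> \<rightarrow>\<^sub>M \<gamma>" "distr \<gamma> \<gamma> (\<lambda>\<omega>. \<omega> \<circ> T) = \<gamma>"
proof -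
  have s: "sets \<gamma> = sets (PiM UNIV (\<lambda>_. borel))" and pr: "prob_space \<gamma>"
    and d: "\<And>xs. distr \<gamma> borel (lincomb xs) = centered_normal (qform K xs)"
    using \<gamma> unfolding Gaussian_field_def by auto
  show m: "(\<lambda>\<omega>. \<omega> \<circ> T) \<in> \<gamma> \<rightarrow>\<^sub>M \<gamma>"
    unfolding measurable_cong_sets[OF s s] comp_def
    by (rule measurable_PiM_single') (auto simp: space_PiM)
  show "distr \<gamma> \<gamma> (\<lambda>\<omega>. \<omega> \<circ> T) = \<gamma>"
  proof (rule Cramer_Wold_PiM[where I = UNIV])
    show "prob_space (distr \<gamma> \<gamma> (\<lambda>\<omega>. \<omega> \<circ> T))"
      by (intro prob_space.prob_space_distr pr m)
    fix xs
    have l: "lincomb xs \<in> \<gamma> \<rightarrow>\<^sub>M borel"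
      unfolding measurable_cong_sets[OF s refl]
      by (intro lincomb_measurable measurable_component_singleton) auto
    \<comment> \<open>Composing with \<open>T\<close> amounts to relabelling the indices of the
      combination by \<open>T\<close>, and \<open>qform\<close> does not see this relabelling. The
      scaling by 1 only makes \<open>lincomb_map_scale\<close> applicable.\<close>
    have l': "lincomb xs (\<omega> \<circ> T) = lincomb (map (map_prod ((*) 1) T) xs) \<omega>" for \<omega>
      by (simp only: lincomb_map_scale comp_def mult_1)
    have "distr (distr \<gamma> \<gamma> (\<lambda>\<omega>. \<omega> \<circ> T)) borel (lincomb xs) = distr \<gamma> borel (lincomb (map (map_prod ((*) 1) T) xs))"
      by (subst distr_distr[OF l m]) (simp add: comp_def l'[unfolded comp_def])
    also have "\<dots> = distr \<gamma> borel (lincomb xs)"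
      unfolding d qform_def lincomb_map_scale by (simp add: T)
    finally show "distr (distr \<gamma> \<gamma> (\<lambda>\<omega>. \<omega> \<circ> T)) borel (lincomb xs) = distr \<gamma> borel (lincomb xs)" .
  qed (use s pr in auto)
qed

section \<open>Continuity of the action on functions\<close>

text \<open>Takes the place of Minkowski's inequality: both terms are at most their maximum, and the
  factor \<open>2 powr p\<close> is harmless in limits that are 0.\<close>

lemma powr_abs_add_le:
  fixes x y p :: real
  assumes "p \<ge> 0"
  shows "\<bar>x + y\<bar> powr p \<le> 2 powr p * (\<bar>x\<bar> powr p + \<bar>y\<bar> powr p)"
proof -
  define m where "m = max \<bar>x\<bar> \<bar>y\<bar>"
  have "\<bar>x + y\<bar> powr p \<le> (2 * m) powr p"
    using assms by (intro powr_mono2) (auto simp: m_def)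
  also have "\<dots> = 2 powr p * m powr p"
    by (simp add: powr_mult m_def)
  also have "m powr p \<le> \<bar>x\<bar> powr p + \<bar>y\<bar> powr p"
    by (auto simp: m_def max_def)
  finally show ?thesis by simp
qed

lemma integrable_powr_abs_add:
  fixes f g :: "'a \<Rightarrow> real"
  assumes p: "p \<ge> 0" and [measurable]: "f \<in> borel_measurable M" "g \<in> borel_measurable M"
    and f: "integrable M (\<lambda>x. \<bar>f x\<bar> powr p)" and g: "integrable M (\<lambda>x. \<bar>g x\<bar> powr p)"
  shows "integrable M (\<lambda>x. \<bar>f x + g x\<bar> powr p)"
    "(\<integral>x. \<bar>f x + g x\<bar> powr p \<partial>M) \<le> 2 powr p * ((\<integral>x. \<bar>f x\<bar> powr p \<partial>M) + (\<integral>x. \<bar>g x\<bar> powr p \<partial>M))"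
proof -
  have i: "integrable M (\<lambda>x. 2 powr p * (\<bar>f x\<bar> powr p + \<bar>g x\<bar> powr p))"
    using f g by auto
  show j: "integrable M (\<lambda>x. \<bar>f x + g x\<bar> powr p)"
    using powr_abs_add_le[OF p] by (intro Bochner_Integration.integrable_bound[OF i]) (auto intro!: AE_I2)
  have "(\<integral>x. \<bar>f x + g x\<bar> powr p \<partial>M) \<le> (\<integral>x. 2 powr p * (\<bar>f x\<bar> powr p + \<bar>g x\<bar> powr p) \<partial>M)"
    using powr_abs_add_le[OF p] by (intro integral_mono i j)
  then show "(\<integral>x. \<bar>f x + g x\<bar> powr p \<partial>M) \<le> 2 powr p * ((\<integral>x. \<bar>f x\<bar> powr p \<partial>M) + (\<integral>x. \<bar>g x\<bar> powr p \<partial>M))"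
    using f g by simp
qed

lemma integrable_powr_abs_diff:
  fixes f g :: "'a \<Rightarrow> real"
  assumes p: "p \<ge> 0" and [measurable]: "f \<in> borel_measurable M" "g \<in> borel_measurable M"
    and f: "integrable M (\<lambda>x. \<bar>f x\<bar> powr p)" and g: "integrable M (\<lambda>x. \<bar>g x\<bar> powr p)"
  shows "integrable M (\<lambda>x. \<bar>f x - g x\<bar> powr p)"
    "(\<integral>x. \<bar>f x - g x\<bar> powr p \<partial>M) \<le> 2 powr p * ((\<integral>x. \<bar>f x\<bar> powr p \<partial>M) + (\<integral>x. \<bar>g x\<bar> powr p \<partial>M))"
  using integrable_powr_abs_add[OF p, of f M "\<lambda>x. - g x"] f g by auto

lemma tendsto_0_sandwich:
  fixes f g :: "'a \<Rightarrow> real"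
  assumes "\<And>x. 0 \<le> f x" "\<And>x. f x \<le> g x" "(g \<longlongrightarrow> 0) F"
  shows "(f \<longlongrightarrow> 0) F"
  by (rule tendsto_sandwich[OF _ _ tendsto_const assms(3)]) (auto simp: assms)

text \<open>The error \<open>t n\<close> is uniform in \<open>x\<close>, so \<open>n\<close> can be
  fixed before passing to the limit along \<open>F\<close>.\<close>

lemma tendsto_0_approx:
  fixes f g :: "'a \<Rightarrow> real" and h :: "nat \<Rightarrow> 'a \<Rightarrow> real"
  assumes "\<And>x. 0 \<le> f x" "\<And>n x. f x \<le> h n x + t n" "\<And>n. (h n \<longlongrightarrow> 0) F" "t \<longlonglongrightarrow> 0"
  shows "(f \<longlongrightarrow> 0) F"
proof (rule tendstoI)
  fix e :: real assume "e > 0"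
  have "eventually (\<lambda>n. t n < e / 2) sequentially"
    using order_tendstoD(2)[OF assms(4), of "e / 2"] \<open>e > 0\<close> by simp
  then obtain n where n: "t n < e / 2"
    by (auto simp: eventually_sequentially)
  have "eventually (\<lambda>x. h n x < e / 2) F"
    using order_tendstoD(2)[OF assms(3), of "e / 2"] \<open>e > 0\<close> by simp
  then show "eventually (\<lambda>x. dist (f x) 0 < e) F"
  proof eventually_elim
    case (elim x)
    then show ?case using assms(1)[of x] assms(2)[of x n] n by simp
  qed
qed

text \<open>Convergence is assumed only in probability and for each coordinate separately.
  Preservation of \<gamma> by every map is what lets it reach functions of all coordinates. The
  instances are a neighbourhood filter in the group and a constant sequence.\<close>

locale convergent_coordinate_maps = prob_space \<gamma>
  for \<gamma> :: "('i \<Rightarrow> real) measure" +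
  fixes \<Phi> :: "'a \<Rightarrow> ('i \<Rightarrow> real) \<Rightarrow> 'i \<Rightarrow> real" and \<Phi>0 and F :: "'a filter"
  assumes sets_PiM: "sets \<gamma> = sets (PiM UNIV (\<lambda>_. borel))"
    and \<Phi>_measurable [measurable]: "\<And>a. \<Phi> a \<in> \<gamma> \<rightarrow>\<^sub>M \<gamma>" and \<Phi>_distr: "\<And>a. distr \<gamma> \<gamma> (\<Phi> a) = \<gamma>"
    and \<Phi>0_measurable [measurable]: "\<Phi>0 \<in> \<gamma> \<rightarrow>\<^sub>M \<gamma>" and \<Phi>0_distr: "distr \<gamma> \<gamma> \<Phi>0 = \<gamma>"
    and conv: "\<And>i \<delta>. \<delta> > 0 \<Longrightarrow> ((\<lambda>a. prob {\<omega>. \<delta> < \<bar>\<Phi> a \<omega> i - \<Phi>0 \<omega> i\<bar>}) \<longlongrightarrow> 0) F"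
begin

lemma space_UNIV: "space \<gamma> = UNIV"
  using sets_eq_imp_space_eq[OF sets_PiM] by (simp add: space_PiM)

lemma coordinate_measurable [measurable]: "(\<lambda>\<omega>. \<omega> i) \<in> borel_measurable \<gamma>"
  unfolding measurable_cong_sets[OF sets_PiM refl] by measurable

lemma prob_preserved:
  assumes "\<Psi> \<in> \<gamma> \<rightarrow>\<^sub>M \<gamma>" "distr \<gamma> \<gamma> \<Psi> = \<gamma>" "A \<in> sets \<gamma>"
  shows "prob (\<Psi> -` A) = prob A" "\<Psi> -` A \<in> sets \<gamma>"
  using measure_distr[OF assms(1,3)] measurable_sets[OF assms(1,3)] assms(2) by (auto simp: space_UNIV)

definition sym_diff_preimages :: "'a \<Rightarrow> ('i \<Rightarrow> real) set \<Rightarrow> ('i \<Rightarrow> real) set" where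
  "sym_diff_preimages a A = {\<omega>. (\<Phi> a \<omega> \<in> A) \<noteq> (\<Phi>0 \<omega> \<in> A)}"

lemma sym_diff_preimages_sets [measurable]:
  "A \<in> sets \<gamma> \<Longrightarrow> sym_diff_preimages a A \<in> sets \<gamma>"
proof -
  assume [measurable]: "A \<in> sets \<gamma>"
  have "{\<omega> \<in> space \<gamma>. (\<Phi> a \<omega> \<in> A) \<noteq> (\<Phi>0 \<omega> \<in> A)} \<in> sets \<gamma>" by measurable
  then show ?thesis by (simp add: sym_diff_preimages_def space_UNIV)
qed

definition stable_sets :: "('i \<Rightarrow> real) set set" where
  "stable_sets = {A \<in> sets \<gamma>. ((\<lambda>a. prob (sym_diff_preimages a A)) \<longlongrightarrow> 0) F}"

text \<open>A countable union differs from a finite one by a set \<open>R n\<close> of small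
  probability. Its preimages under \<open>\<Phi> a\<close> and \<open>\<Phi>0\<close> are equally
  small for every \<open>a\<close>, since the maps preserve \<gamma>; this is the uniform error
  \<open>2 * prob (R n)\<close>.\<close>

lemma sigma_algebra_stable_sets: "sigma_algebra UNIV stable_sets"
  unfolding sigma_algebra_iff2
proof (intro conjI ballI allI impI)
  show "stable_sets \<subseteq> Pow UNIV" by simp
  show "{} \<in> stable_sets"
    by (simp add: stable_sets_def sym_diff_preimages_def)
  fix A assume "A \<in> stable_sets"
  moreover have "sym_diff_preimages a (UNIV - A) = sym_diff_preimages a A" for a
    by (auto simp: sym_diff_preimages_def)
  ultimately show "UNIV - A \<in> stable_sets"
    unfolding stable_sets_def using sets.compl_sets[of A \<gamma>] by (auto simp: space_UNIV)
next
  fix A :: "nat \<Rightarrow> _" assume A: "range A \<subseteq> stable_sets"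
  then have [measurable]: "A i \<in> sets \<gamma>" for i unfolding stable_sets_def by auto
  define U where "U = (\<Union>i. A i)"
  define R where "R n = U - (\<Union>i<n. A i)" for n
  have [measurable]: "U \<in> sets \<gamma>" "R n \<in> sets \<gamma>" for n unfolding U_def R_def by auto
  have "(\<lambda>n. prob (R n)) \<longlonglongrightarrow> prob (\<Inter>n. R n)"
    by (intro finite_Lim_measure_decseq) (auto simp: decseq_def R_def)
  moreover have "(\<Inter>n. R n) = {}"
    unfolding R_def U_def by auto
  ultimately have R0: "(\<lambda>n. 2 * prob (R n)) \<longlonglongrightarrow> 0"
    using tendsto_mult_left[of "\<lambda>n. prob (R n)" 0 sequentially 2] by simp
  have "((\<lambda>a. prob (sym_diff_preimages a U)) \<longlongrightarrow> 0) F"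
  proof (rule tendsto_0_approx[OF _ _ _ R0])
    fix n a
    have "sym_diff_preimages a U \<subseteq> (\<Union>i<n. sym_diff_preimages a (A i)) \<union> (\<Phi> a -` R n \<union> \<Phi>0 -` R n)"
      unfolding sym_diff_preimages_def R_def U_def by auto
    then have "prob (sym_diff_preimages a U) \<le> prob ((\<Union>i<n. sym_diff_preimages a (A i)) \<union> (\<Phi> a -` R n \<union> \<Phi>0 -` R n))"
      using prob_preserved[OF \<Phi>_measurable \<Phi>_distr] prob_preserved[OF \<Phi>0_measurable \<Phi>0_distr]
      by (intro finite_measure_mono) auto
    also have "\<dots> \<le> prob (\<Union>i<n. sym_diff_preimages a (A i)) + prob (\<Phi> a -` R n \<union> \<Phi>0 -` R n)"
      using prob_preserved[OF \<Phi>_measurable \<Phi>_distr] prob_preserved[OF \<Phi>0_measurable \<Phi>0_distr]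
      by (intro measure_Un_le) auto
    also have "\<dots> \<le> (\<Sum>i<n. prob (sym_diff_preimages a (A i))) + (prob (\<Phi> a -` R n) + prob (\<Phi>0 -` R n))"
      using prob_preserved[OF \<Phi>_measurable \<Phi>_distr] prob_preserved[OF \<Phi>0_measurable \<Phi>0_distr]
      by (intro add_mono measure_Un_le finite_measure_subadditive_finite) auto
    also have "\<dots> = (\<Sum>i<n. prob (sym_diff_preimages a (A i))) + 2 * prob (R n)"
      by (simp add: prob_preserved[OF \<Phi>_measurable \<Phi>_distr] prob_preserved[OF \<Phi>0_measurable \<Phi>0_distr])
    finally show "prob (sym_diff_preimages a U) \<le> (\<Sum>i<n. prob (sym_diff_preimages a (A i))) + 2 * prob (R n)" .
    show "((\<lambda>a. \<Sum>i<n. prob (sym_diff_preimages a (A i))) \<longlongrightarrow> 0) F"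
      using A by (intro tendsto_null_sum) (auto simp: stable_sets_def)
  qed simp
  then show "(\<Union>i. A i) \<in> stable_sets"
    unfolding stable_sets_def U_def[symmetric] by simp
qed

text \<open>A point where exactly one of \<open>\<Phi> a \<omega> i\<close>, \<open>\<Phi>0 \<omega> i\<close> is at most \<open>c\<close> either has them far apart or puts
the larger one just above \<open>c\<close>. Hence only intervals open at \<open>c\<close> occur, and atoms do no harm.\<close>

lemma halfspace_stable: "{\<omega>. \<omega> i \<le> c} \<in> stable_sets"
proof -
  define B where "B n = {\<omega>. c < \<omega> i \<and> \<omega> i \<le> c + 1 / Suc n}" for n :: nat
  have B [measurable]: "B n \<in> sets \<gamma>" for n
  proof -
    have "{\<omega> \<in> space \<gamma>. c < \<omega> i \<and> \<omega> i \<le> c + 1 / Suc n} \<in> sets \<gamma>" by measurable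
    then show ?thesis by (simp add: B_def space_UNIV)
  qed
  have H: "{\<omega>. \<omega> i \<le> c} \<in> sets \<gamma>"
  proof -
    have "{\<omega> \<in> space \<gamma>. \<omega> i \<le> c} \<in> sets \<gamma>" by measurable
    then show ?thesis by (simp add: space_UNIV)
  qed
  have "(\<lambda>n. prob (B n)) \<longlonglongrightarrow> prob (\<Inter>n. B n)"
  proof (intro finite_Lim_measure_decseq)
    show "decseq B"
    proof (rule decseq_SucI)
      fix n
      have "1 / real (Suc (Suc n)) \<le> 1 / real (Suc n)" by (intro divide_left_mono) auto
      then show "B (Suc n) \<le> B n" unfolding B_def by auto
    qed
  qed auto
  moreover have "(\<Inter>n. B n) = {}"
  proof (intro equals0I)
    fix \<omega> assume \<omega>: "\<omega> \<in> (\<Inter>n. B n)"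
    then have "\<omega> i - c > 0" unfolding B_def by auto
    then obtain n where "1 / real (Suc n) < \<omega> i - c"
      using nat_approx_posE by blast
    moreover have "\<omega> i \<le> c + 1 / Suc n" using \<omega> unfolding B_def by auto
    ultimately show False by simp
  qed
  ultimately have B0: "(\<lambda>n. 2 * prob (B n)) \<longlonglongrightarrow> 0"
    using tendsto_mult_left[of "\<lambda>n. prob (B n)" 0 sequentially 2] by simp
  have "((\<lambda>a. prob (sym_diff_preimages a {\<omega>. \<omega> i \<le> c})) \<longlongrightarrow> 0) F"
  proof (rule tendsto_0_approx[OF _ _ _ B0])
    fix n :: nat and a
    let ?D = "{\<omega>. 1 / Suc n < \<bar>\<Phi> a \<omega> i - \<Phi>0 \<omega> i\<bar>}"
    show "((\<lambda>a. prob {\<omega>. 1 / Suc n < \<bar>\<Phi> a \<omega> i - \<Phi>0 \<omega> i\<bar>}) \<longlongrightarrow> 0) F"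
      by (rule conv) simp
    have [measurable]: "(\<lambda>\<omega>. \<Phi> a \<omega> i) \<in> borel_measurable \<gamma>" "(\<lambda>\<omega>. \<Phi>0 \<omega> i) \<in> borel_measurable \<gamma>"
      using measurable_compose[OF \<Phi>_measurable coordinate_measurable] measurable_compose[OF \<Phi>0_measurable coordinate_measurable] by auto
    have "{\<omega> \<in> space \<gamma>. 1 / Suc n < \<bar>\<Phi> a \<omega> i - \<Phi>0 \<omega> i\<bar>} \<in> sets \<gamma>" by measurable
    then have D: "?D \<in> sets \<gamma>" by (simp add: space_UNIV)
    have "sym_diff_preimages a {\<omega>. \<omega> i \<le> c} \<subseteq> ?D \<union> (\<Phi> a -` B n \<union> \<Phi>0 -` B n)"
    proof
      fix \<omega> assume "\<omega> \<in> sym_diff_preimages a {\<omega>. \<omega> i \<le> c}"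
      then show "\<omega> \<in> ?D \<union> (\<Phi> a -` B n \<union> \<Phi>0 -` B n)"
        unfolding sym_diff_preimages_def B_def by (auto simp: not_le)
    qed
    then have "prob (sym_diff_preimages a {\<omega>. \<omega> i \<le> c}) \<le> prob (?D \<union> (\<Phi> a -` B n \<union> \<Phi>0 -` B n))"
      using prob_preserved[OF \<Phi>_measurable \<Phi>_distr] prob_preserved[OF \<Phi>0_measurable \<Phi>0_distr] D
      by (intro finite_measure_mono) auto
    also have "\<dots> \<le> prob ?D + prob (\<Phi> a -` B n \<union> \<Phi>0 -` B n)"
      using prob_preserved[OF \<Phi>_measurable \<Phi>_distr] prob_preserved[OF \<Phi>0_measurable \<Phi>0_distr] D
      by (intro measure_Un_le) auto
    also have "\<dots> \<le> prob ?D + (prob (\<Phi> a -` B n) + prob (\<Phi>0 -` B n))"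
      using prob_preserved[OF \<Phi>_measurable \<Phi>_distr] prob_preserved[OF \<Phi>0_measurable \<Phi>0_distr]
      by (intro add_mono measure_Un_le order_refl) auto
    finally show "prob (sym_diff_preimages a {\<omega>. \<omega> i \<le> c}) \<le> prob ?D + 2 * prob (B n)"
      by (simp add: prob_preserved[OF \<Phi>_measurable \<Phi>_distr] prob_preserved[OF \<Phi>0_measurable \<Phi>0_distr])
  qed simp
  with H show ?thesis unfolding stable_sets_def by simp
qed

text \<open>By \<open>halfspace_stable\<close> every coordinate is measurable for the sigma-algebra
  of stable sets, so that sigma-algebra contains the product one. The inclusion is expressed as
  measurability of the identity.\<close>

lemma all_sets_stable: "A \<in> sets \<gamma> \<Longrightarrow> ((\<lambda>a. prob (sym_diff_preimages a A)) \<longlongrightarrow> 0) F"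
proof -
  assume A: "A \<in> sets \<gamma>"
  interpret S: sigma_algebra UNIV stable_sets by (rule sigma_algebra_stable_sets)
  let ?S = "sigma UNIV stable_sets"
  have S [simp]: "sets ?S = stable_sets" "space ?S = UNIV" by auto
  have "(\<lambda>\<omega>. \<omega> i) \<in> borel_measurable ?S" for i
    by (rule borel_measurableI_le) (use halfspace_stable in simp)
  then have "(\<lambda>\<omega>. \<omega>) \<in> ?S \<rightarrow>\<^sub>M PiM UNIV (\<lambda>_. borel)"
    by (intro measurable_PiM_single') auto
  from measurable_sets[OF this, of A] have "A \<in> stable_sets"
    using A sets_PiM by simp
  then show ?thesis unfolding stable_sets_def by simp
qed

lemma integral_preserved:
  fixes f :: "('i \<Rightarrow> real) \<Rightarrow> real"
  assumes "\<Psi> \<in> \<gamma> \<rightarrow>\<^sub>M \<gamma>" "distr \<gamma> \<gamma> \<Psi> = \<gamma>" "f \<in> borel_measurable \<gamma>"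
  shows "(\<integral>\<omega>. f (\<Psi> \<omega>) \<partial>\<gamma>) = (\<integral>\<omega>. f \<omega> \<partial>\<gamma>)" "integrable \<gamma> (\<lambda>\<omega>. f (\<Psi> \<omega>)) \<longleftrightarrow> integrable \<gamma> f"
  using integral_distr[OF assms(1,3)] integrable_distr_eq[OF assms(1,3)] assms(2) by auto

text \<open>For one term the integrand is a constant times the indicator of a set
  \<open>sym_diff_preimages a (A j)\<close>. Measurability and integrability are carried along
  because the induction step needs them for the partial sum.\<close>

lemma simple_Lp_convergence:
  fixes c :: "'b \<Rightarrow> real"
  assumes "finite J" "\<And>j. j \<in> J \<Longrightarrow> A j \<in> sets \<gamma>" and p: "p > 0"
  defines "s \<equiv> \<lambda>\<omega>. \<Sum>j\<in>J. c j * indicator (A j) \<omega>"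
  shows "s \<in> borel_measurable \<gamma> \<and> integrable \<gamma> (\<lambda>\<omega>. \<bar>s \<omega>\<bar> powr p) \<and>
    ((\<lambda>a. \<integral>\<omega>. \<bar>s (\<Phi> a \<omega>) - s (\<Phi>0 \<omega>)\<bar> powr p \<partial>\<gamma>) \<longlongrightarrow> 0) F"
  using assms(1,2) unfolding s_def
proof (induction J)
  case (insert j J)
  define s where "s \<omega> = (\<Sum>j\<in>J. c j * indicator (A j) \<omega>)" for \<omega>
  define u where "u \<omega> = c j * indicator (A j) \<omega>" for \<omega>
  have [measurable]: "A j \<in> sets \<gamma>" using insert.prems by auto
  have [measurable]: "s \<in> borel_measurable \<gamma>" and s: "integrable \<gamma> (\<lambda>\<omega>. \<bar>s \<omega>\<bar> powr p)"
    "((\<lambda>a. \<integral>\<omega>. \<bar>s (\<Phi> a \<omega>) - s (\<Phi>0 \<omega>)\<bar> powr p \<partial>\<gamma>) \<longlongrightarrow> 0) F"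
    using insert by (auto simp: s_def[abs_def])
  have [measurable]: "u \<in> borel_measurable \<gamma>" unfolding u_def by measurable
  have u: "integrable \<gamma> (\<lambda>\<omega>. \<bar>u \<omega>\<bar> powr p)"
    using p by (intro integrable_const_bound[where B = "\<bar>c j\<bar> powr p"]) (auto simp: u_def indicator_def)
  have "\<bar>u (\<Phi> a \<omega>) - u (\<Phi>0 \<omega>)\<bar> powr p = \<bar>c j\<bar> powr p * indicator (sym_diff_preimages a (A j)) \<omega>" for a \<omega>
    using p by (auto simp: u_def sym_diff_preimages_def indicator_def)
  then have "(\<integral>\<omega>. \<bar>u (\<Phi> a \<omega>) - u (\<Phi>0 \<omega>)\<bar> powr p \<partial>\<gamma>) = \<bar>c j\<bar> powr p * prob (sym_diff_preimages a (A j))" for a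
    using sets.sets_into_space[OF sym_diff_preimages_sets[of "A j" a]] by (simp add: Int_absorb2)
  then have u0: "((\<lambda>a. \<integral>\<omega>. \<bar>u (\<Phi> a \<omega>) - u (\<Phi>0 \<omega>)\<bar> powr p \<partial>\<gamma>) \<longlongrightarrow> 0) F"
    using tendsto_mult_left[OF all_sets_stable[of "A j"], of "\<bar>c j\<bar> powr p"] by simp
  have "((\<lambda>a. \<integral>\<omega>. \<bar>(u (\<Phi> a \<omega>) + s (\<Phi> a \<omega>)) - (u (\<Phi>0 \<omega>) + s (\<Phi>0 \<omega>))\<bar> powr p \<partial>\<gamma>) \<longlongrightarrow> 0) F"
  proof (rule tendsto_0_sandwich)
    show "((\<lambda>a. 2 powr p * ((\<integral>\<omega>. \<bar>u (\<Phi> a \<omega>) - u (\<Phi>0 \<omega>)\<bar> powr p \<partial>\<gamma>) + (\<integral>\<omega>. \<bar>s (\<Phi> a \<omega>) - s (\<Phi>0 \<omega>)\<bar> powr p \<partial>\<gamma>))) \<longlongrightarrow> 0) F"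
      using tendsto_mult_left[OF tendsto_add[OF u0 s(2)], of "2 powr p"] by simp
    fix a
    have "integrable \<gamma> (\<lambda>\<omega>. \<bar>f (\<Phi> a \<omega>) - f (\<Phi>0 \<omega>)\<bar> powr p)"
      if [measurable]: "f \<in> borel_measurable \<gamma>" and "integrable \<gamma> (\<lambda>\<omega>. \<bar>f \<omega>\<bar> powr p)" for f
      using that(2) p integral_preserved(2)[OF \<Phi>_measurable \<Phi>_distr, of "\<lambda>\<omega>. \<bar>f \<omega>\<bar> powr p"]
        integral_preserved(2)[OF \<Phi>0_measurable \<Phi>0_distr, of "\<lambda>\<omega>. \<bar>f \<omega>\<bar> powr p"]
      by (intro integrable_powr_abs_diff) auto
    then show "(\<integral>\<omega>. \<bar>(u (\<Phi> a \<omega>) + s (\<Phi> a \<omega>)) - (u (\<Phi>0 \<omega>) + s (\<Phi>0 \<omega>))\<bar> powr p \<partial>\<gamma>)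
      \<le> 2 powr p * ((\<integral>\<omega>. \<bar>u (\<Phi> a \<omega>) - u (\<Phi>0 \<omega>)\<bar> powr p \<partial>\<gamma>) + (\<integral>\<omega>. \<bar>s (\<Phi> a \<omega>) - s (\<Phi>0 \<omega>)\<bar> powr p \<partial>\<gamma>))"
      using integrable_powr_abs_add(2)[of p "\<lambda>\<omega>. u (\<Phi> a \<omega>) - u (\<Phi>0 \<omega>)" \<gamma> "\<lambda>\<omega>. s (\<Phi> a \<omega>) - s (\<Phi>0 \<omega>)"] p s u
      by (simp add: algebra_simps)
  qed simp
  moreover have "integrable \<gamma> (\<lambda>\<omega>. \<bar>u \<omega> + s \<omega>\<bar> powr p)"
    using p s u by (intro integrable_powr_abs_add) auto
  moreover have "(\<lambda>\<omega>. u \<omega> + s \<omega>) \<in> borel_measurable \<gamma>" by measurable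
  ultimately show ?case
    unfolding u_def s_def sum.insert[OF insert.hyps] by blast
qed simp

text \<open>Simple functions approximate \<open>f\<close> in \<open>L_p\<close>, and since the maps
  preserve \<gamma> the approximation error after composing with \<open>\<Phi> a\<close> is the same
  for every \<open>a\<close>.\<close>

theorem Lp_convergence:
  fixes f :: "('i \<Rightarrow> real) \<Rightarrow> real"
  assumes f [measurable]: "f \<in> borel_measurable \<gamma>" and fp: "integrable \<gamma> (\<lambda>\<omega>. \<bar>f \<omega>\<bar> powr p)" and p: "p > 0"
  shows "((\<lambda>a. \<integral>\<omega>. \<bar>f (\<Phi> a \<omega>) - f (\<Phi>0 \<omega>)\<bar> powr p \<partial>\<gamma>) \<longlongrightarrow> 0) F"
proof -
  obtain s where "\<forall>i. simple_function \<gamma> (s i)" "\<forall>\<omega>\<in>space \<gamma>. (\<lambda>i. s i \<omega>) \<longlonglongrightarrow> f \<omega>"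
    "\<forall>i. \<forall>\<omega>\<in>space \<gamma>. norm (s i \<omega>) \<le> 2 * norm (f \<omega>)"
    using borel_measurable_implies_sequence_metric[OF f, of 0] by auto
  then have s: "\<And>i. simple_function \<gamma> (s i)" "\<And>\<omega>. \<omega> \<in> space \<gamma> \<Longrightarrow> (\<lambda>i. s i \<omega>) \<longlonglongrightarrow> f \<omega>"
    "\<And>i \<omega>. \<omega> \<in> space \<gamma> \<Longrightarrow> norm (s i \<omega>) \<le> 2 * norm (f \<omega>)"
    by auto
  have s_meas [measurable]: "s i \<in> borel_measurable \<gamma>" for i
    using s(1) by (rule borel_measurable_simple_function)
  have s_conv: "integrable \<gamma> (\<lambda>\<omega>. \<bar>s n \<omega>\<bar> powr p)"
    "((\<lambda>a. \<integral>\<omega>. \<bar>s n (\<Phi> a \<omega>) - s n (\<Phi>0 \<omega>)\<bar> powr p \<partial>\<gamma>) \<longlongrightarrow> 0) F" for n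
  proof -
    have eq: "(\<Sum>y\<in>range (s n). y * indicator (s n -` {y}) \<omega>) = s n \<omega>" for \<omega>
      using simple_function_indicator_representation_banach[OF s(1)[of n], of \<omega>]
      by (simp only: space_UNIV UNIV_I Int_UNIV_right real_scaleR_def mult.commute)
    have "finite (range (s n))" "s n -` {y} \<in> sets \<gamma>" for y
      using simple_functionD[OF s(1)[of n]] by (auto simp: space_UNIV)
    from simple_Lp_convergence[OF this p, of "\<lambda>y. y" "\<lambda>y. y", unfolded eq]
    show "integrable \<gamma> (\<lambda>\<omega>. \<bar>s n \<omega>\<bar> powr p)"
      "((\<lambda>a. \<integral>\<omega>. \<bar>s n (\<Phi> a \<omega>) - s n (\<Phi>0 \<omega>)\<bar> powr p \<partial>\<gamma>) \<longlongrightarrow> 0) F"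
      by auto
  qed
  define t where "t n = (\<integral>\<omega>. \<bar>f \<omega> - s n \<omega>\<bar> powr p \<partial>\<gamma>)" for n
  have fs: "integrable \<gamma> (\<lambda>\<omega>. \<bar>f \<omega> - s n \<omega>\<bar> powr p)" for n
    using fp s_conv p by (intro integrable_powr_abs_diff) auto
  have "t \<longlonglongrightarrow> (\<integral>\<omega>. 0 \<partial>\<gamma>)"
    unfolding t_def
  \<comment> \<open>The approximants satisfy
    \<open>\<bar>s n \<omega>\<bar> \<le> 2 * \<bar>f \<omega>\<bar>\<close>, which gives the factor
    3.\<close>
  proof (rule integral_dominated_convergence[where w = "\<lambda>\<omega>. 3 powr p * \<bar>f \<omega>\<bar> powr p"])
    show "integrable \<gamma> (\<lambda>\<omega>. 3 powr p * \<bar>f \<omega>\<bar> powr p)" using fp by simp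
    show "AE \<omega> in \<gamma>. (\<lambda>n. \<bar>f \<omega> - s n \<omega>\<bar> powr p) \<longlonglongrightarrow> 0"
    proof (intro AE_I2)
      fix \<omega> assume "\<omega> \<in> space \<gamma>"
      then have "(\<lambda>n. \<bar>f \<omega> - s n \<omega>\<bar>) \<longlonglongrightarrow> 0"
        using tendsto_rabs_zero[OF LIM_zero[OF s(2)]] by (simp add: abs_minus_commute)
      then show "(\<lambda>n. \<bar>f \<omega> - s n \<omega>\<bar> powr p) \<longlonglongrightarrow> 0"
        using p by (intro tendsto_zero_powrI[where b = p]) auto
    qed
    show "AE \<omega> in \<gamma>. norm (\<bar>f \<omega> - s n \<omega>\<bar> powr p) \<le> 3 powr p * \<bar>f \<omega>\<bar> powr p" for n
    proof (intro AE_I2)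
      fix \<omega> assume "\<omega> \<in> space \<gamma>"
      then have "\<bar>f \<omega> - s n \<omega>\<bar> \<le> 3 * \<bar>f \<omega>\<bar>" using s(3)[of \<omega> n] by simp
      then have "\<bar>f \<omega> - s n \<omega>\<bar> powr p \<le> (3 * \<bar>f \<omega>\<bar>) powr p" using p by (intro powr_mono2) auto
      then show "norm (\<bar>f \<omega> - s n \<omega>\<bar> powr p) \<le> 3 powr p * \<bar>f \<omega>\<bar> powr p" by (simp add: powr_mult)
    qed
  qed auto
  \<comment> \<open>The outer \<open>2 powr p\<close> comes from splitting \<open>f\<close> into
    \<open>s n\<close> and the remainder \<open>d\<close>, the inner one from splitting
    \<open>d (\<Phi> a \<omega>) - d (\<Phi>0 \<omega>)\<close>, whose two parts contribute
    \<open>t n\<close> each.\<close>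
  then have t0: "(\<lambda>n. 2 powr p * (2 powr p * (2 * t n))) \<longlonglongrightarrow> 0"
    using tendsto_mult_left[of t 0 sequentially "2 powr p * 2 powr p * 2"] by (simp add: mult_ac)
  show ?thesis
  proof (rule tendsto_0_approx[OF _ _ _ t0])
    fix n
    show "((\<lambda>a. 2 powr p * (\<integral>\<omega>. \<bar>s n (\<Phi> a \<omega>) - s n (\<Phi>0 \<omega>)\<bar> powr p \<partial>\<gamma>)) \<longlongrightarrow> 0) F"
      using tendsto_mult_left[OF s_conv(2)[of n], of "2 powr p"] by simp
    fix a
    define d where "d \<omega> = f \<omega> - s n \<omega>" for \<omega>
    have [measurable]: "d \<in> borel_measurable \<gamma>" unfolding d_def by measurable
    have d: "integrable \<gamma> (\<lambda>\<omega>. \<bar>d (\<Psi> \<omega>)\<bar> powr p)" "(\<integral>\<omega>. \<bar>d (\<Psi> \<omega>)\<bar> powr p \<partial>\<gamma>) = t n"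
      and sn: "integrable \<gamma> (\<lambda>\<omega>. \<bar>s n (\<Psi> \<omega>)\<bar> powr p)"
      if "\<Psi> \<in> \<gamma> \<rightarrow>\<^sub>M \<gamma>" "distr \<gamma> \<gamma> \<Psi> = \<gamma>" for \<Psi>
      using integral_preserved[OF that, of "\<lambda>\<omega>. \<bar>d \<omega>\<bar> powr p"] integral_preserved[OF that, of "\<lambda>\<omega>. \<bar>s n \<omega>\<bar> powr p"]
        fs[of n] s_conv(1)[of n] by (auto simp: d_def t_def)
    note dd = d[OF \<Phi>_measurable[of a] \<Phi>_distr] d[OF \<Phi>0_measurable \<Phi>0_distr]
    have "integrable \<gamma> (\<lambda>\<omega>. \<bar>d (\<Phi> a \<omega>) - d (\<Phi>0 \<omega>)\<bar> powr p)"
      "(\<integral>\<omega>. \<bar>d (\<Phi> a \<omega>) - d (\<Phi>0 \<omega>)\<bar> powr p \<partial>\<gamma>) \<le> 2 powr p * (2 * t n)"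
      using integrable_powr_abs_diff[of p "\<lambda>\<omega>. d (\<Phi> a \<omega>)" \<gamma> "\<lambda>\<omega>. d (\<Phi>0 \<omega>)"] p dd by auto
    moreover have "integrable \<gamma> (\<lambda>\<omega>. \<bar>s n (\<Phi> a \<omega>) - s n (\<Phi>0 \<omega>)\<bar> powr p)"
      using p sn[OF \<Phi>_measurable[of a] \<Phi>_distr] sn[OF \<Phi>0_measurable \<Phi>0_distr]
      by (intro integrable_powr_abs_diff) auto
    moreover have "f (\<Phi> a \<omega>) - f (\<Phi>0 \<omega>) = (s n (\<Phi> a \<omega>) - s n (\<Phi>0 \<omega>)) + (d (\<Phi> a \<omega>) - d (\<Phi>0 \<omega>))" for \<omega>
      by (simp add: d_def)
    ultimately have "(\<integral>\<omega>. \<bar>f (\<Phi> a \<omega>) - f (\<Phi>0 \<omega>)\<bar> powr p \<partial>\<gamma>)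
      \<le> 2 powr p * ((\<integral>\<omega>. \<bar>s n (\<Phi> a \<omega>) - s n (\<Phi>0 \<omega>)\<bar> powr p \<partial>\<gamma>) + (\<integral>\<omega>. \<bar>d (\<Phi> a \<omega>) - d (\<Phi>0 \<omega>)\<bar> powr p \<partial>\<gamma>))"
      using integrable_powr_abs_add(2)[of p "\<lambda>\<omega>. s n (\<Phi> a \<omega>) - s n (\<Phi>0 \<omega>)" \<gamma> "\<lambda>\<omega>. d (\<Phi> a \<omega>) - d (\<Phi>0 \<omega>)"] p
      by simp
    also have "\<dots> \<le> 2 powr p * ((\<integral>\<omega>. \<bar>s n (\<Phi> a \<omega>) - s n (\<Phi>0 \<omega>)\<bar> powr p \<partial>\<gamma>) + 2 powr p * (2 * t n))"
      using \<open>(\<integral>\<omega>. \<bar>d (\<Phi> a \<omega>) - d (\<Phi>0 \<omega>)\<bar> powr p \<partial>\<gamma>) \<le> 2 powr p * (2 * t n)\<close> by (intro mult_left_mono add_left_mono) auto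
    finally show "(\<integral>\<omega>. \<bar>f (\<Phi> a \<omega>) - f (\<Phi>0 \<omega>)\<bar> powr p \<partial>\<gamma>)
      \<le> 2 powr p * (\<integral>\<omega>. \<bar>s n (\<Phi> a \<omega>) - s n (\<Phi>0 \<omega>)\<bar> powr p \<partial>\<gamma>) + 2 powr p * (2 powr p * (2 * t n))"
      by (simp add: distrib_left)
  qed simp
qed

end

section \<open>The Gaussian process indexed by a Hilbert space\<close>

lemma Lp_set_add:
  assumes "p \<ge> 0" "u \<in> Lp_set p M" "v \<in> Lp_set p M"
  shows "(\<lambda>x. u x + v x) \<in> Lp_set p M"
  using assms integrable_powr_abs_add(1)[of p u M v] by (auto simp: Lp_set_def)

lemma Lp_set_diff:
  assumes "p \<ge> 0" "u \<in> Lp_set p M" "v \<in> Lp_set p M"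
  shows "(\<lambda>x. u x - v x) \<in> Lp_set p M"
  using assms integrable_powr_abs_diff(1)[of p u M v] by (auto simp: Lp_set_def)

lemma Lp_set_scale: "u \<in> Lp_set p M \<Longrightarrow> (\<lambda>x. t * u x) \<in> Lp_set p M"
  by (auto simp: Lp_set_def abs_mult powr_mult)

lemma Lp_set_zero: "p > 0 \<Longrightarrow> (\<lambda>_. 0) \<in> Lp_set p M"
  by (auto simp: Lp_set_def)

lemma Lp_dist_eq_0_iff:
  assumes p: "p > 0" and u: "u \<in> Lp_set p M" and v: "v \<in> Lp_set p M"
  shows "Lp_dist p M u v = 0 \<longleftrightarrow> (AE x in M. u x = v x)"
proof -
  have "integrable M (\<lambda>x. \<bar>u x - v x\<bar> powr p)"
    using Lp_set_diff[OF _ u v] p by (auto simp: Lp_set_def)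
  from integral_nonneg_eq_0_iff_AE[OF this] show ?thesis
    using p by (simp add: Lp_dist_def Lp_norm_def)
qed

lemma Lp_dist_tendsto_0:
  assumes p: "p > 0" and "((\<lambda>a. \<integral>x. \<bar>u a x - v a x\<bar> powr p \<partial>M) \<longlongrightarrow> 0) F"
  shows "((\<lambda>a. Lp_dist p M (u a) (v a)) \<longlongrightarrow> 0) F"
  unfolding Lp_dist_def Lp_norm_def
  by (rule tendsto_zero_powrI[where b = "1 / p"]) (use assms in auto)

lemma abs_powr_2: "\<bar>x :: real\<bar> powr 2 = x\<^sup>2"
  by (cases "x = 0") (auto simp: powr_numeral)

lemma L2_iff: "u \<in> Lp_set 2 M \<longleftrightarrow> u \<in> borel_measurable M \<and> integrable M (\<lambda>x. (u x)\<^sup>2)"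
  by (simp add: Lp_set_def abs_powr_2)

lemma L2_dist: "Lp_dist 2 M u v = sqrt (\<integral>x. (u x - v x)\<^sup>2 \<partial>M)"
  by (simp add: Lp_dist_def Lp_norm_def abs_powr_2 powr_half_sqrt)

lemma L2_integrable_mult:
  assumes "u \<in> Lp_set 2 M" "v \<in> Lp_set 2 M"
  shows "integrable M (\<lambda>x. u x * v x)"
proof (rule Bochner_Integration.integrable_bound[where f = "\<lambda>x. (u x)\<^sup>2 + (v x)\<^sup>2"])
  show "AE x in M. norm (u x * v x) \<le> norm ((u x)\<^sup>2 + (v x)\<^sup>2)"
  proof (intro AE_I2)
    fix x
    have "2 * (\<bar>u x\<bar> * \<bar>v x\<bar>) \<le> (u x)\<^sup>2 + (v x)\<^sup>2"
      using sum_squares_bound[of "\<bar>u x\<bar>" "\<bar>v x\<bar>"] by simp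
    moreover have "0 \<le> \<bar>u x\<bar> * \<bar>v x\<bar>" by simp
    ultimately show "norm (u x * v x) \<le> norm ((u x)\<^sup>2 + (v x)\<^sup>2)"
      unfolding real_norm_def abs_mult by linarith
  qed
qed (use assms in \<open>auto simp: L2_iff\<close>)

text \<open>The differences make the inner product a function of distances, the only data that the
  action is known to preserve.\<close>

lemma L2_polarization:
  assumes "u \<in> Lp_set 2 M" "v \<in> Lp_set 2 M"
  shows "(\<integral>x. u x * v x \<partial>M) = ((\<integral>x. (u x)\<^sup>2 \<partial>M) + (\<integral>x. (v x)\<^sup>2 \<partial>M) - (\<integral>x. (u x - v x)\<^sup>2 \<partial>M)) / 2"
proof -
  have "(\<integral>x. (u x - v x)\<^sup>2 \<partial>M) = (\<integral>x. ((u x)\<^sup>2 + (v x)\<^sup>2) - 2 * (u x * v x) \<partial>M)"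
    by (simp add: power2_diff mult.assoc)
  also have "\<dots> = (\<integral>x. (u x)\<^sup>2 \<partial>M) + (\<integral>x. (v x)\<^sup>2 \<partial>M) - 2 * (\<integral>x. u x * v x \<partial>M)"
    using assms L2_integrable_mult[OF assms] by (simp add: L2_iff)
  finally show ?thesis by simp
qed

definition L2_part :: "'v measure \<Rightarrow> ('v \<Rightarrow> real) \<Rightarrow> 'v \<Rightarrow> real" where
  "L2_part M u = (if u \<in> Lp_set 2 M then u else (\<lambda>_. 0))"

text \<open>The index set of the Gaussian process is the whole function type; functions outside \<open>L_2\<close> get the
variance zero.\<close>

definition L2_kernel :: "'v measure \<Rightarrow> ('v \<Rightarrow> real) \<Rightarrow> ('v \<Rightarrow> real) \<Rightarrow> real" where
  "L2_kernel M u v = (\<integral>x. L2_part M u x * L2_part M v x \<partial>M)"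

lemma L2_part_in: "L2_part M u \<in> Lp_set 2 M"
  by (simp add: L2_part_def Lp_set_zero)

lemma lincomb_L2_part_in: "(\<lambda>x. lincomb xs (\<lambda>u. L2_part M u x)) \<in> Lp_set 2 M"
proof (induction xs)
  case (Cons a xs)
  then show ?case
    using Lp_set_add[OF _ Lp_set_scale[OF L2_part_in, of "fst a" M "snd a"] Cons] by (cases a) simp
qed (simp add: Lp_set_zero)

lemma lincomb_L2_integral:
  assumes w: "w \<in> Lp_set 2 M"
  shows "lincomb xs (\<lambda>u. \<integral>x. L2_part M u x * w x \<partial>M) = (\<integral>x. lincomb xs (\<lambda>u. L2_part M u x) * w x \<partial>M)"
proof (induction xs)
  case (Cons a xs)
  obtain t u where [simp]: "a = (t, u)" by (cases a)
  have "(\<integral>x. (t * L2_part M u x + lincomb xs (\<lambda>u. L2_part M u x)) * w x \<partial>M)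
    = (\<integral>x. t * (L2_part M u x * w x) + lincomb xs (\<lambda>u. L2_part M u x) * w x \<partial>M)"
    by (simp add: algebra_simps)
  also have "\<dots> = t * (\<integral>x. L2_part M u x * w x \<partial>M) + (\<integral>x. lincomb xs (\<lambda>u. L2_part M u x) * w x \<partial>M)"
    using L2_integrable_mult[OF L2_part_in w] L2_integrable_mult[OF lincomb_L2_part_in w] by simp
  finally show ?case using Cons by simp
qed simp

text \<open>Besides positivity of the kernel, this yields that a combination vanishing in
  \<open>L_2\<close> has variance 0.\<close>

lemma qform_L2_kernel: "qform (L2_kernel M) xs = (\<integral>x. (lincomb xs (\<lambda>u. L2_part M u x))\<^sup>2 \<partial>M)"
proof -
  have "lincomb xs (L2_kernel M u) = (\<integral>x. L2_part M u x * lincomb xs (\<lambda>v. L2_part M v x) \<partial>M)" for u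
    using lincomb_L2_integral[OF L2_part_in, of xs M u]
    by (simp add: L2_kernel_def[abs_def] mult.commute)
  then have "qform (L2_kernel M) xs = lincomb xs (\<lambda>u. \<integral>x. L2_part M u x * lincomb xs (\<lambda>v. L2_part M v x) \<partial>M)"
    by (simp add: qform_def)
  also have "\<dots> = (\<integral>x. lincomb xs (\<lambda>u. L2_part M u x) * lincomb xs (\<lambda>v. L2_part M v x) \<partial>M)"
    by (rule lincomb_L2_integral[OF lincomb_L2_part_in])
  finally show ?thesis by (simp add: power2_eq_square)
qed

lemma psd_L2_kernel: "psd_kernel (L2_kernel M)"
  unfolding psd_kernel_def
  by (auto simp: qform_L2_kernel) (simp add: L2_kernel_def mult.commute)

section \<open>Moments of the field and almost sure linear relations\<close>

definition std_normal_abs_moment :: "real \<Rightarrow> real" where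
  "std_normal_abs_moment p = (\<integral>x. \<bar>x\<bar> powr p \<partial>std_normal_distribution)"

lemma integrable_std_normal_abs_powr:
  assumes "p > 0"
  shows "integrable std_normal_distribution (\<lambda>x. \<bar>x\<bar> powr p)"
proof -
  \<comment> \<open>The dominating polynomial uses the even power \<open>2 * n\<close>, which is
    nonnegative and exceeds \<open>p\<close>; the summand 1 covers
    \<open>\<bar>x\<bar> \<le> 1\<close>.\<close>
  obtain n :: nat where n: "p \<le> real n" using real_arch_simple by blast
  interpret N: prob_space std_normal_distribution
    using real_dist_normal_dist by (simp add: real_distribution_def)
  have le: "\<bar>x\<bar> powr p \<le> 1 + x ^ (2 * n)" for x :: real
  proof (cases "\<bar>x\<bar> \<le> 1")
    case True
    then have "\<bar>x\<bar> powr p \<le> 1 powr p" using assms by (intro powr_mono2) auto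
    also have "\<dots> \<le> 1 + x ^ (2 * n)" by (simp add: power_mult)
    finally show ?thesis .
  next
    case False
    then have "\<bar>x\<bar> powr p \<le> \<bar>x\<bar> powr real (2 * n)" using n by (intro powr_mono) auto
    also have "\<dots> = x ^ (2 * n)" using False by (subst powr_realpow) (auto simp: power_mult)
    finally show ?thesis by simp
  qed
  show ?thesis
  proof (rule Bochner_Integration.integrable_bound[where f = "\<lambda>x. 1 + x ^ (2 * n)"])
    show "integrable std_normal_distribution (\<lambda>x. 1 + x ^ (2 * n))"
      using integrable_std_normal_distribution_moment[of "2 * n"] by simp
    show "AE x in std_normal_distribution. norm (\<bar>x\<bar> powr p) \<le> norm (1 + x ^ (2 * n))"
      using le by (intro AE_I2) (simp add: order.trans[OF _ abs_ge_self])
  qed simp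
qed

text \<open>A zero moment would make the standard normal variable vanish almost surely,
  contradicting its variance 1.\<close>

lemma std_normal_abs_moment_pos:
  assumes "p > 0"
  shows "std_normal_abs_moment p > 0"
proof (rule ccontr)
  interpret N: prob_space std_normal_distribution
    using real_dist_normal_dist by (simp add: real_distribution_def)
  assume "\<not> std_normal_abs_moment p > 0"
  moreover have "std_normal_abs_moment p \<ge> 0" unfolding std_normal_abs_moment_def by simp
  ultimately have "std_normal_abs_moment p = 0" by simp
  then have "AE x in std_normal_distribution. x = 0"
    using integral_nonneg_eq_0_iff_AE[OF integrable_std_normal_abs_powr[OF assms]] assms
    by (simp add: std_normal_abs_moment_def)
  then have "(\<integral>x. x ^ (2 * 1) \<partial>std_normal_distribution) = 0"
    by (intro integral_eq_zero_AE) auto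
  then show False
    using std_normal_distribution_even_moments(1)[of 1] by simp
qed

lemma lincomb_field_measurable:
  assumes "Gaussian_field K \<gamma>"
  shows "lincomb xs \<in> borel_measurable \<gamma>"
proof -
  have "sets \<gamma> = sets (PiM UNIV (\<lambda>_. borel))" using assms unfolding Gaussian_field_def by simp
  then show ?thesis
    by (subst measurable_cong_sets[OF _ refl]) (auto intro!: lincomb_measurable measurable_component_singleton)
qed

lemma Gaussian_field_space: "Gaussian_field K \<gamma> \<Longrightarrow> space \<gamma> = UNIV"
  unfolding Gaussian_field_def using sets_eq_imp_space_eq[of \<gamma> "PiM UNIV (\<lambda>_. borel)"] by (simp add: space_PiM)

lemma coordinate_field_measurable: "Gaussian_field K \<gamma> \<Longrightarrow> (\<lambda>\<omega>. \<omega> i) \<in> borel_measurable \<gamma>"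
  using lincomb_field_measurable[of K \<gamma> "[(1, i)]"] by (simp cong: measurable_cong)

lemma Gaussian_field_moment:
  assumes \<gamma>: "Gaussian_field K \<gamma>" and p: "p > 0"
  shows "integrable \<gamma> (\<lambda>\<omega>. \<bar>lincomb xs \<omega>\<bar> powr p)"
    "(\<integral>\<omega>. \<bar>lincomb xs \<omega>\<bar> powr p \<partial>\<gamma>) = \<bar>sqrt (qform K xs)\<bar> powr p * std_normal_abs_moment p"
proof -
  have d: "distr \<gamma> borel (lincomb xs) = distr std_normal_distribution borel (\<lambda>x. sqrt (qform K xs) * x)"
    using \<gamma> unfolding Gaussian_field_def centered_normal_def by blast
  note m = lincomb_field_measurable[OF \<gamma>, of xs]
  have e: "\<bar>sqrt (qform K xs) * x\<bar> powr p = \<bar>sqrt (qform K xs)\<bar> powr p * \<bar>x\<bar> powr p" for x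
    by (simp add: abs_mult powr_mult)
  have "integrable \<gamma> (\<lambda>\<omega>. \<bar>lincomb xs \<omega>\<bar> powr p) \<longleftrightarrow> integrable (distr \<gamma> borel (lincomb xs)) (\<lambda>x. \<bar>x\<bar> powr p)"
    by (subst integrable_distr_eq[OF m]) auto
  also have "\<dots> \<longleftrightarrow> integrable std_normal_distribution (\<lambda>x. \<bar>sqrt (qform K xs) * x\<bar> powr p)"
    unfolding d by (subst integrable_distr_eq) auto
  finally show "integrable \<gamma> (\<lambda>\<omega>. \<bar>lincomb xs \<omega>\<bar> powr p)"
    unfolding e using integrable_std_normal_abs_powr[OF p] by simp
  have "(\<integral>\<omega>. \<bar>lincomb xs \<omega>\<bar> powr p \<partial>\<gamma>) = (\<integral>x. \<bar>x\<bar> powr p \<partial>distr \<gamma> borel (lincomb xs))"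
    by (subst integral_distr[OF m]) auto
  also have "\<dots> = (\<integral>x. \<bar>sqrt (qform K xs) * x\<bar> powr p \<partial>std_normal_distribution)"
    unfolding d by (subst integral_distr) auto
  finally show "(\<integral>\<omega>. \<bar>lincomb xs \<omega>\<bar> powr p \<partial>\<gamma>) = \<bar>sqrt (qform K xs)\<bar> powr p * std_normal_abs_moment p"
    unfolding e by (simp add: std_normal_abs_moment_def)
qed

lemma field_in_Lp:
  assumes "Gaussian_field K \<gamma>" "p > 0"
  shows "(\<lambda>\<omega>. lincomb xs \<omega>) \<in> Lp_set p \<gamma>" "(\<lambda>\<omega>. \<omega> i) \<in> Lp_set p \<gamma>"
  using lincomb_field_measurable[OF assms(1), of xs] Gaussian_field_moment(1)[OF assms, of xs]
    coordinate_field_measurable[OF assms(1), of i] Gaussian_field_moment(1)[OF assms, of "[(1, i)]"]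
  by (auto simp: Lp_set_def)

lemma L2_field_distance_moment:
  assumes \<gamma>: "Gaussian_field (L2_kernel M) \<gamma>" and p: "p > 0"
    and u: "u \<in> Lp_set 2 M" and v: "v \<in> Lp_set 2 M"
  shows "(\<integral>\<omega>. \<bar>\<omega> u - \<omega> v\<bar> powr p \<partial>\<gamma>) = Lp_dist 2 M u v powr p * std_normal_abs_moment p"
  using Gaussian_field_moment(2)[OF \<gamma> p, of "[(1, u), (-1, v)]"] u v
  by (simp add: qform_L2_kernel L2_part_def L2_dist)

text \<open>The factor does not depend on \<open>u\<close> and \<open>v\<close>, so passing to the
  field rescales all distances alike and keeps every compression exponent.\<close>

lemma L2_field_Lp_dist:
  assumes \<gamma>: "Gaussian_field (L2_kernel M) \<gamma>" and p: "p > 0"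
    and u: "u \<in> Lp_set 2 M" and v: "v \<in> Lp_set 2 M"
  shows "Lp_dist p \<gamma> (\<lambda>\<omega>. \<omega> u) (\<lambda>\<omega>. \<omega> v) = std_normal_abs_moment p powr (1 / p) * Lp_dist 2 M u v"
proof -
  have "0 \<le> Lp_dist 2 M u v" by (simp add: L2_dist)
  then show ?thesis
    using std_normal_abs_moment_pos[OF p] p
    by (simp add: Lp_dist_def[of p] Lp_norm_def L2_field_distance_moment[OF assms] powr_mult powr_powr)
qed

text \<open>The combination has variance 0. This replaces linearity of the sample points: each
  single linear relation in \<open>L_2\<close> holds almost surely for the coordinates.\<close>

lemma L2_field_AE_relation:
  assumes \<gamma>: "Gaussian_field (L2_kernel M) \<gamma>" and z: "AE x in M. lincomb xs (\<lambda>u. L2_part M u x) = 0"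
  shows "AE \<omega> in \<gamma>. lincomb xs \<omega> = 0"
proof -
  have "qform (L2_kernel M) xs = 0"
    unfolding qform_L2_kernel using z by (intro integral_eq_zero_AE) auto
  then have "(\<integral>\<omega>. \<bar>lincomb xs \<omega>\<bar> powr 1 \<partial>\<gamma>) = 0"
    using Gaussian_field_moment(2)[OF \<gamma>, of 1 xs] by simp
  then show ?thesis
    using integral_nonneg_eq_0_iff_AE[OF Gaussian_field_moment(1)[OF \<gamma>, of 1 xs]] by simp
qed

lemma L2_field_AE_eq:
  assumes \<gamma>: "Gaussian_field (L2_kernel M) \<gamma>" and "u \<in> Lp_set 2 M" "v \<in> Lp_set 2 M" "AE x in M. u x = v x"
  shows "AE \<omega> in \<gamma>. \<omega> u = \<omega> v"
  using L2_field_AE_relation[OF \<gamma>, of "[(1, u), (-1, v)]"] assms(2-) by (simp add: L2_part_def)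

lemma L2_field_AE_add:
  assumes \<gamma>: "Gaussian_field (L2_kernel M) \<gamma>" and "u \<in> Lp_set 2 M" "v \<in> Lp_set 2 M" "w \<in> Lp_set 2 M"
    and "AE x in M. u x = v x + w x"
  shows "AE \<omega> in \<gamma>. \<omega> u = \<omega> v + \<omega> w"
  using L2_field_AE_relation[OF \<gamma>, of "[(1, u), (-1, v), (-1, w)]"] assms(2-)
  by (simp add: L2_part_def algebra_simps)

text \<open>The index set may be uncountable, so \<open>\<Psi> = \<Psi>'\<close> need not hold almost everywhere; the claim comes
from \<open>Lp_convergence\<close> for a constant sequence.\<close>

lemma AE_eq_compose:
  fixes \<Psi> \<Psi>' :: "('i \<Rightarrow> real) \<Rightarrow> 'i \<Rightarrow> real"
  assumes \<gamma>: "Gaussian_field K \<gamma>"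
    and \<Psi>: "\<Psi> \<in> \<gamma> \<rightarrow>\<^sub>M \<gamma>" "distr \<gamma> \<gamma> \<Psi> = \<gamma>" and \<Psi>': "\<Psi>' \<in> \<gamma> \<rightarrow>\<^sub>M \<gamma>" "distr \<gamma> \<gamma> \<Psi>' = \<gamma>"
    and ae: "\<And>i. AE \<omega> in \<gamma>. \<Psi> \<omega> i = \<Psi>' \<omega> i"
    and p: "p > 0" and F: "F \<in> Lp_set p \<gamma>"
  shows "AE \<omega> in \<gamma>. F (\<Psi> \<omega>) = F (\<Psi>' \<omega>)"
proof -
  interpret prob_space \<gamma> using \<gamma> unfolding Gaussian_field_def by simp
  interpret convergent_coordinate_maps \<gamma> "\<lambda>_ :: nat. \<Psi>" \<Psi>' sequentially
  proof
    show "sets \<gamma> = sets (PiM UNIV (\<lambda>_. borel))" using \<gamma> unfolding Gaussian_field_def by simp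
    fix i and \<delta> :: real assume "\<delta> > 0"
    have "prob {\<omega>. \<delta> < \<bar>\<Psi> \<omega> i - \<Psi>' \<omega> i\<bar>} = 0"
    proof (rule measure_eq_0_null_sets, rule AE_iff_null_sets[THEN iffD2])
      have [measurable]: "(\<lambda>\<omega>. \<Psi> \<omega> i) \<in> borel_measurable \<gamma>" "(\<lambda>\<omega>. \<Psi>' \<omega> i) \<in> borel_measurable \<gamma>"
        using measurable_compose[OF _ coordinate_field_measurable[OF \<gamma>]] \<Psi>(1) \<Psi>'(1) by auto
      have "{\<omega> \<in> space \<gamma>. \<delta> < \<bar>\<Psi> \<omega> i - \<Psi>' \<omega> i\<bar>} \<in> events" by measurable
      then show "{\<omega>. \<delta> < \<bar>\<Psi> \<omega> i - \<Psi>' \<omega> i\<bar>} \<in> events" by (simp add: Gaussian_field_space[OF \<gamma>])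
    qed (use ae[of i] \<open>\<delta> > 0\<close> in auto)
    then show "(\<lambda>a :: nat. prob {\<omega>. \<delta> < \<bar>\<Psi> \<omega> i - \<Psi>' \<omega> i\<bar>}) \<longlonglongrightarrow> 0" by simp
  qed (use \<Psi> \<Psi>' in auto)
  have F': "F \<in> borel_measurable \<gamma>" "integrable \<gamma> (\<lambda>\<omega>. \<bar>F \<omega>\<bar> powr p)"
    using F by (auto simp: Lp_set_def)
  have 0: "(\<integral>\<omega>. \<bar>F (\<Psi> \<omega>) - F (\<Psi>' \<omega>)\<bar> powr p \<partial>\<gamma>) = 0"
    using Lp_convergence[OF F' p] by (simp add: LIMSEQ_const_iff)
  have "(\<lambda>\<omega>. F (\<Psi> \<omega>)) \<in> Lp_set p \<gamma>" "(\<lambda>\<omega>. F (\<Psi>' \<omega>)) \<in> Lp_set p \<gamma>"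
    using integral_preserved(2)[OF \<Psi>, of "\<lambda>\<omega>. \<bar>F \<omega>\<bar> powr p"] integral_preserved(2)[OF \<Psi>', of "\<lambda>\<omega>. \<bar>F \<omega>\<bar> powr p"] F' \<Psi> \<Psi>'
    by (auto simp: Lp_set_def)
  then show ?thesis
    using Lp_dist_eq_0_iff[OF p, of "\<lambda>\<omega>. F (\<Psi> \<omega>)" \<gamma> "\<lambda>\<omega>. F (\<Psi>' \<omega>)"] 0 p by (simp add: Lp_dist_def Lp_norm_def)
qed

section \<open>Transfer of actions and compression\<close>

text \<open>Identities for the linear part \<open>T\<close> and the translation part
  \<open>b\<close> hold almost everywhere on \<open>M\<close>. The field turns them into almost sure
  identities of single coordinates, and \<open>AE_eq_compose\<close> extends these to arbitrary
  \<open>F\<close>.\<close>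

lemma equivariant_L2_to_Lp:
  fixes f :: "'g::{topological_space,group_add} \<Rightarrow> 'v \<Rightarrow> real"
  assumes f: "equivariant 2 M f" and p: "p \<ge> 1"
    and \<gamma>: "Gaussian_field (L2_kernel M) \<gamma>"
  shows "equivariant p \<gamma> (\<lambda>g \<omega>. \<omega> (f g))"
proof -
  have p0: "p > 0" using p by simp
  obtain \<alpha> where fL: "\<And>g. f g \<in> Lp_set 2 M"
    and \<alpha>: "affine_isometric_action 2 M \<alpha>"
    and f\<alpha>: "\<And>g h. Lp_dist 2 M (f (g + h)) (\<alpha> g (f h)) = 0"
    using f unfolding equivariant_def by blast
  have \<alpha>L: "\<And>g u. u \<in> Lp_set 2 M \<Longrightarrow> \<alpha> g u \<in> Lp_set 2 M"
    and \<alpha>_iso: "\<And>g u v. u \<in> Lp_set 2 M \<Longrightarrow> v \<in> Lp_set 2 M \<Longrightarrow> Lp_dist 2 M (\<alpha> g u) (\<alpha> g v) = Lp_dist 2 M u v"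
    and \<alpha>_0: "\<And>u. u \<in> Lp_set 2 M \<Longrightarrow> Lp_dist 2 M (\<alpha> 0 u) u = 0"
    and \<alpha>_add: "\<And>g h u. u \<in> Lp_set 2 M \<Longrightarrow> Lp_dist 2 M (\<alpha> (g + h) u) (\<alpha> g (\<alpha> h u)) = 0"
    and \<alpha>_cont: "\<And>u g0 e. u \<in> Lp_set 2 M \<Longrightarrow> e > 0 \<Longrightarrow> \<exists>U. open U \<and> g0 \<in> U \<and> (\<forall>g\<in>U. Lp_dist 2 M (\<alpha> g u) (\<alpha> g0 u) < e)"
    using \<alpha> unfolding affine_isometric_action_def by blast+
  interpret prob_space \<gamma> using \<gamma> unfolding Gaussian_field_def by simp

  define z :: "'v \<Rightarrow> real" where "z = (\<lambda>_. 0)"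
  have zL: "z \<in> Lp_set 2 M" by (simp add: z_def Lp_set_zero)
  define b where "b g = \<alpha> g z" for g
  have bL: "b g \<in> Lp_set 2 M" for g unfolding b_def by (intro \<alpha>L zL)
  \<comment> \<open>The identity outside \<open>L_2\<close> makes \<open>T g\<close> act on the
    whole index type. The kernel is 0 there, so it is still preserved.\<close>
  define T where "T g u = (if u \<in> Lp_set 2 M then (\<lambda>x. \<alpha> g u x - b g x) else u)" for g u
  have TL: "T g u \<in> Lp_set 2 M" if "u \<in> Lp_set 2 M" for g u
    using that bL \<alpha>L by (simp add: T_def Lp_set_diff)
  have sq_iso: "(\<integral>x. (\<alpha> g u x - \<alpha> g v x)\<^sup>2 \<partial>M) = (\<integral>x. (u x - v x)\<^sup>2 \<partial>M)"
    if "u \<in> Lp_set 2 M" "v \<in> Lp_set 2 M" for g u v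
    using \<alpha>_iso[OF that, of g] by (simp add: L2_dist)
  have T_kernel: "L2_kernel M (T g u) (T g v) = L2_kernel M u v" for g u v
  proof (cases "u \<in> Lp_set 2 M \<and> v \<in> Lp_set 2 M")
    case True
    then have u: "u \<in> Lp_set 2 M" and v: "v \<in> Lp_set 2 M" by auto
    have "L2_kernel M (T g u) (T g v) = (\<integral>x. T g u x * T g v x \<partial>M)"
      using TL u v by (simp add: L2_kernel_def L2_part_def)
    also have "\<dots> = ((\<integral>x. (u x - z x)\<^sup>2 \<partial>M) + (\<integral>x. (v x - z x)\<^sup>2 \<partial>M) - (\<integral>x. (u x - v x)\<^sup>2 \<partial>M)) / 2"
      unfolding L2_polarization[OF TL[OF u] TL[OF v]] using u v zL
      by (simp add: T_def b_def sq_iso)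
    also have "\<dots> = (\<integral>x. u x * v x \<partial>M)"
      using L2_polarization[OF u v] by (simp add: z_def)
    also have "\<dots> = L2_kernel M u v"
      using u v by (simp add: L2_kernel_def L2_part_def)
    finally show ?thesis .
  next
    case False
    then show ?thesis by (auto simp: L2_kernel_def L2_part_def T_def)
  qed
  txt \<open>Linearity of \<open>T g\<close> comes from preservation of inner products alone: the square norm of
    \<open>T g (u - v) - T g u + T g v\<close> expands to that of \<open>(u - v) - u + v\<close>.\<close>
  have T_diff: "AE x in M. T g (\<lambda>x. u x - v x) x = T g u x - T g v x"
    if u: "u \<in> Lp_set 2 M" and v: "v \<in> Lp_set 2 M" for g u v
  proof -
    have uv: "(\<lambda>x. u x - v x) \<in> Lp_set 2 M" using u v by (simp add: Lp_set_diff)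
    let ?xs = "[(1, \<lambda>x. u x - v x), (-1, u), (1, v)]"
    have "(\<integral>x. (T g (\<lambda>x. u x - v x) x - T g u x + T g v x)\<^sup>2 \<partial>M)
      = qform (L2_kernel M) (map (map_prod ((*) 1) (T g)) ?xs)"
      unfolding qform_L2_kernel using u v uv TL by (simp add: L2_part_def algebra_simps)
    also have "\<dots> = qform (L2_kernel M) ?xs"
      unfolding qform_def lincomb_map_scale T_kernel by simp
    also have "\<dots> = 0"
      unfolding qform_L2_kernel using u v uv by (simp add: L2_part_def)
    finally have "(\<integral>x. (T g (\<lambda>x. u x - v x) x - T g u x + T g v x)\<^sup>2 \<partial>M) = 0" .
    moreover have "(\<lambda>x. T g (\<lambda>x. u x - v x) x - T g u x + T g v x) \<in> Lp_set 2 M"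
      using TL u v uv by (intro Lp_set_add Lp_set_diff) auto
    ultimately have "AE x in M. (T g (\<lambda>x. u x - v x) x - T g u x + T g v x)\<^sup>2 = 0"
      using integral_nonneg_eq_0_iff_AE[of M "\<lambda>x. (T g (\<lambda>x. u x - v x) x - T g u x + T g v x)\<^sup>2"] by (simp add: L2_iff)
    then show ?thesis by eventually_elim simp
  qed
  have ae: "AE x in M. u x = v x" if "Lp_dist 2 M u v = 0" "u \<in> Lp_set 2 M" "v \<in> Lp_set 2 M" for u v
    using Lp_dist_eq_0_iff[OF _ that(2,3)] that(1) by simp
  \<comment> \<open>The cocycle identity is the action law evaluated at the origin
    \<open>z\<close>.\<close>
  have b_add: "AE x in M. b (g + h) x = T g (b h) x + b g x" for g h
    using ae[OF \<alpha>_add[OF zL, of g h] \<alpha>L[OF zL] \<alpha>L[OF \<alpha>L[OF zL]]] bL[of h]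
    by (simp add: T_def b_def)
  have T_add: "AE x in M. T (g + h) u x = T g (T h u) x" if u: "u \<in> Lp_set 2 M" for g h u
  proof -
    \<comment> \<open>\<open>T h u\<close> is \<open>\<alpha> h u - b h\<close>, so
      \<open>T_diff\<close> splits it; the translation parts then cancel by the cocycle
      identity.\<close>
    have "AE x in M. T g (T h u) x = T g (\<alpha> h u) x - T g (b h) x"
      using T_diff[OF \<alpha>L[OF u, of h] bL[of h], of g] u by (simp add: T_def[of h])
    moreover have "AE x in M. \<alpha> (g + h) u x = \<alpha> g (\<alpha> h u) x"
      using ae[OF \<alpha>_add[OF u, of g h] \<alpha>L[OF u] \<alpha>L[OF \<alpha>L[OF u]]] .
    ultimately show ?thesis
      using b_add[of g h]
    proof eventually_elim
      case (elim x)
      then show ?case using u bL[of h] \<alpha>L[OF u, of h] by (simp add: T_def[of "g + h"] T_def[of g "\<alpha> h u"])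
    qed
  qed

  \<comment> \<open>Precomposition reverses the order: \<open>\<Phi> h (\<Phi> g \<omega>)\<close>
    is \<open>\<omega> \<circ> T g \<circ> T h\<close>, to be matched with
    \<open>\<Phi> (g + h) \<omega>\<close>. Substitution into \<open>F\<close> reverses it once
    more, which gives a left action.\<close>
  define \<Phi> where "\<Phi> g \<omega> = \<omega> \<circ> T g" for g and \<omega> :: "('v \<Rightarrow> real) \<Rightarrow> real"
  have \<Phi>: "\<Phi> g \<in> \<gamma> \<rightarrow>\<^sub>M \<gamma>" "distr \<gamma> \<gamma> (\<Phi> g) = \<gamma>" for g
    unfolding \<Phi>_def[abs_def] using Gaussian_field_coordinate_change[OF \<gamma>, of "T g"] T_kernel by auto
  have \<Phi>\<Phi>: "(\<lambda>\<omega>. \<Phi> h (\<Phi> g \<omega>)) \<in> \<gamma> \<rightarrow>\<^sub>M \<gamma>" "distr \<gamma> \<gamma> (\<lambda>\<omega>. \<Phi> h (\<Phi> g \<omega>)) = \<gamma>" for g h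
    using measurable_compose[OF \<Phi>(1) \<Phi>(1)] distr_distr[OF \<Phi>(1)[of h] \<Phi>(1)[of g]] \<Phi>(2) by (auto simp: comp_def)
  have id_pres: "(\<lambda>\<omega>. \<omega>) \<in> \<gamma> \<rightarrow>\<^sub>M \<gamma>" "distr \<gamma> \<gamma> (\<lambda>\<omega>. \<omega>) = \<gamma>"
    by (auto simp: distr_id2)
  have \<Phi>_int: "(\<integral>\<omega>. F (\<Phi> g \<omega>) \<partial>\<gamma>) = (\<integral>\<omega>. F \<omega> \<partial>\<gamma>)" "integrable \<gamma> (\<lambda>\<omega>. F (\<Phi> g \<omega>)) \<longleftrightarrow> integrable \<gamma> F"
    if "F \<in> borel_measurable \<gamma>" for F :: "_ \<Rightarrow> real" and g
    using integral_distr[OF \<Phi>(1) that] integrable_distr_eq[OF \<Phi>(1) that] \<Phi>(2) by auto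
  have \<Phi>L: "(\<lambda>\<omega>. F (\<Phi> g \<omega>)) \<in> Lp_set p \<gamma>" if "F \<in> Lp_set p \<gamma>" for F g
    using that \<Phi>_int(2)[of "\<lambda>\<omega>. \<bar>F \<omega>\<bar> powr p" g] measurable_compose[OF \<Phi>(1), of F borel g] by (auto simp: Lp_set_def)

  define \<beta> where "\<beta> g F = (\<lambda>\<omega>. F (\<Phi> g \<omega>) + \<omega> (b g))" for g and F :: "(('v \<Rightarrow> real) \<Rightarrow> real) \<Rightarrow> real"
  have coordL: "(\<lambda>\<omega>. \<omega> u) \<in> Lp_set p \<gamma>" for u by (rule field_in_Lp(2)[OF \<gamma> p0])
  have \<beta>L: "\<beta> g F \<in> Lp_set p \<gamma>" if "F \<in> Lp_set p \<gamma>" for g F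
    unfolding \<beta>_def using p by (intro Lp_set_add \<Phi>L that coordL) auto
  have dist0: "Lp_dist p \<gamma> F G = 0" if "AE \<omega> in \<gamma>. F \<omega> = G \<omega>" "F \<in> Lp_set p \<gamma>" "G \<in> Lp_set p \<gamma>" for F G
    using Lp_dist_eq_0_iff[OF p0 that(2,3)] that(1) by simp

  have "affine_isometric_action p \<gamma> \<beta>"
    unfolding affine_isometric_action_def
  proof (intro conjI allI ballI impI)
    fix g :: 'g and F assume F: "F \<in> Lp_set p \<gamma>"
    show "\<beta> g F \<in> Lp_set p \<gamma>" by (rule \<beta>L[OF F])
    fix G assume G: "G \<in> Lp_set p \<gamma>"
    have "(\<lambda>\<omega>. \<bar>F \<omega> - G \<omega>\<bar> powr p) \<in> borel_measurable \<gamma>"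
      using F G by (auto simp: Lp_set_def)
    from \<Phi>_int(1)[OF this, of g] show "Lp_dist p \<gamma> (\<beta> g F) (\<beta> g G) = Lp_dist p \<gamma> F G"
      by (simp add: Lp_dist_def Lp_norm_def \<beta>_def)
    fix t :: real
    show "Lp_dist p \<gamma> (\<beta> g (\<lambda>x. t * F x + (1 - t) * G x)) (\<lambda>x. t * \<beta> g F x + (1 - t) * \<beta> g G x) = 0"
    proof (rule dist0)
      show "\<beta> g (\<lambda>x. t * F x + (1 - t) * G x) \<in> Lp_set p \<gamma>" "(\<lambda>x. t * \<beta> g F x + (1 - t) * \<beta> g G x) \<in> Lp_set p \<gamma>"
        using p F G by (auto intro!: \<beta>L Lp_set_add Lp_set_scale)
    qed (simp add: \<beta>_def algebra_simps)
  next
    fix F assume F: "F \<in> Lp_set p \<gamma>"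
    have b0: "AE x in M. b 0 x = z x"
      using ae[OF \<alpha>_0[OF zL] \<alpha>L[OF zL] zL] by (simp add: b_def)
    have "AE \<omega> in \<gamma>. \<Phi> 0 \<omega> u = \<omega> u" for u
    proof (cases "u \<in> Lp_set 2 M")
      case True
      have "AE x in M. T 0 u x = u x"
        using ae[OF \<alpha>_0[OF True] \<alpha>L[OF True] True] b0
        by eventually_elim (simp add: T_def True z_def)
      from L2_field_AE_eq[OF \<gamma> TL[OF True] True this] show ?thesis by (simp add: \<Phi>_def)
    qed (simp add: \<Phi>_def T_def)
    then have "AE \<omega> in \<gamma>. F (\<Phi> 0 \<omega>) = F \<omega>"
      by (intro AE_eq_compose[OF \<gamma> \<Phi> id_pres _ p0 F])
    moreover have "AE \<omega> in \<gamma>. \<omega> (b 0) = 0"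
      using L2_field_AE_relation[OF \<gamma>, of "[(1, b 0)]"] b0 bL by (simp add: L2_part_def z_def)
    ultimately have "AE \<omega> in \<gamma>. \<beta> 0 F \<omega> = F \<omega>"
      unfolding \<beta>_def by eventually_elim simp
    then show "Lp_dist p \<gamma> (\<beta> 0 F) F = 0" by (intro dist0 \<beta>L F)
  next
    fix g h :: 'g and F assume F: "F \<in> Lp_set p \<gamma>"
    have "AE \<omega> in \<gamma>. \<Phi> (g + h) \<omega> u = \<Phi> h (\<Phi> g \<omega>) u" for u
    proof (cases "u \<in> Lp_set 2 M")
      case True
      from L2_field_AE_eq[OF \<gamma> TL[OF True] TL[OF TL[OF True]] T_add[OF True, of g h]]
      show ?thesis by (simp add: \<Phi>_def)
    qed (simp add: \<Phi>_def T_def)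
    then have "AE \<omega> in \<gamma>. F (\<Phi> (g + h) \<omega>) = F (\<Phi> h (\<Phi> g \<omega>))"
      by (intro AE_eq_compose[OF \<gamma> \<Phi> \<Phi>\<Phi> _ p0 F])
    moreover have "AE \<omega> in \<gamma>. \<omega> (b (g + h)) = \<omega> (T g (b h)) + \<omega> (b g)"
      by (rule L2_field_AE_add[OF \<gamma> bL TL[OF bL] bL b_add])
    ultimately have "AE \<omega> in \<gamma>. \<beta> (g + h) F \<omega> = \<beta> g (\<beta> h F) \<omega>"
    proof eventually_elim
      case (elim \<omega>)
      then show ?case by (simp add: \<beta>_def \<Phi>_def)
    qed
    then show "Lp_dist p \<gamma> (\<beta> (g + h) F) (\<beta> g (\<beta> h F)) = 0" by (intro dist0 \<beta>L F)
  next
    fix F and g0 :: 'g and e :: real assume F: "F \<in> Lp_set p \<gamma>" and "e > 0"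
    have cont: "((\<lambda>g. Lp_dist 2 M (\<alpha> g u) (\<alpha> g0 u)) \<longlongrightarrow> 0) (nhds g0)" if "u \<in> Lp_set 2 M" for u
    proof (rule tendstoI)
      fix e :: real assume "e > 0"
      show "\<forall>\<^sub>F g in nhds g0. dist (Lp_dist 2 M (\<alpha> g u) (\<alpha> g0 u)) 0 < e"
        using \<alpha>_cont[OF that \<open>e > 0\<close>, of g0] unfolding eventually_nhds by (simp add: L2_dist)
    qed
    have cont_field: "((\<lambda>g. \<integral>\<omega>. \<bar>\<omega> (\<alpha> g u) - \<omega> (\<alpha> g0 u)\<bar> powr p \<partial>\<gamma>) \<longlongrightarrow> 0) (nhds g0)" if "u \<in> Lp_set 2 M" for u
    proof -
      have "((\<lambda>g. Lp_dist 2 M (\<alpha> g u) (\<alpha> g0 u) powr p * std_normal_abs_moment p) \<longlongrightarrow> 0) (nhds g0)"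
        by (intro tendsto_mult_left_zero tendsto_zero_powrI[OF cont[OF that] tendsto_const _ p0]) (simp add: L2_dist)
      then show ?thesis
        using L2_field_distance_moment[OF \<gamma> p0 \<alpha>L[OF that] \<alpha>L[OF that]] by simp
    qed
    \<comment> \<open>Almost surely \<open>\<omega> (T g u)\<close> is
      \<open>\<omega> (\<alpha> g u) - \<omega> (b g)\<close>, so continuity of the orbits of
      \<open>u\<close> and of the origin suffices.\<close>
    have cont_T: "((\<lambda>g. \<integral>\<omega>. \<bar>\<omega> (T g u) - \<omega> (T g0 u)\<bar> powr p \<partial>\<gamma>) \<longlongrightarrow> 0) (nhds g0)" if u: "u \<in> Lp_set 2 M" for u
    proof (rule tendsto_0_sandwich)
      show "((\<lambda>g. 2 powr p * ((\<integral>\<omega>. \<bar>\<omega> (\<alpha> g u) - \<omega> (\<alpha> g0 u)\<bar> powr p \<partial>\<gamma>) + (\<integral>\<omega>. \<bar>\<omega> (b g) - \<omega> (b g0)\<bar> powr p \<partial>\<gamma>))) \<longlongrightarrow> 0) (nhds g0)"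
        using tendsto_mult_left[OF tendsto_add[OF cont_field[OF u] cont_field[OF zL]], of "2 powr p"] by (simp add: b_def)
      fix g
      have T_field: "AE \<omega> in \<gamma>. \<omega> (\<alpha> g u) = \<omega> (T g u) + \<omega> (b g)" for g
        using L2_field_AE_add[OF \<gamma> \<alpha>L[OF u] TL[OF u] bL, of g g g] u by (simp add: T_def)
      have "(\<integral>\<omega>. \<bar>\<omega> (T g u) - \<omega> (T g0 u)\<bar> powr p \<partial>\<gamma>)
          = (\<integral>\<omega>. \<bar>(\<omega> (\<alpha> g u) - \<omega> (\<alpha> g0 u)) - (\<omega> (b g) - \<omega> (b g0))\<bar> powr p \<partial>\<gamma>)"
      proof (rule integral_cong_AE)
        show "AE \<omega> in \<gamma>. \<bar>\<omega> (T g u) - \<omega> (T g0 u)\<bar> powr p = \<bar>(\<omega> (\<alpha> g u) - \<omega> (\<alpha> g0 u)) - (\<omega> (b g) - \<omega> (b g0))\<bar> powr p"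
          using T_field[of g] T_field[of g0] by eventually_elim simp
      qed (use coordinate_field_measurable[OF \<gamma>] in measurable)
      also have "\<dots> \<le> 2 powr p * ((\<integral>\<omega>. \<bar>\<omega> (\<alpha> g u) - \<omega> (\<alpha> g0 u)\<bar> powr p \<partial>\<gamma>) + (\<integral>\<omega>. \<bar>\<omega> (b g) - \<omega> (b g0)\<bar> powr p \<partial>\<gamma>))"
      proof (rule integrable_powr_abs_diff(2))
        have "(\<lambda>\<omega>. \<omega> u - \<omega> v) \<in> Lp_set p \<gamma>" for u v
          using p by (intro Lp_set_diff coordL) simp
        then show "(\<lambda>\<omega>. \<omega> (\<alpha> g u) - \<omega> (\<alpha> g0 u)) \<in> borel_measurable \<gamma>" "(\<lambda>\<omega>. \<omega> (b g) - \<omega> (b g0)) \<in> borel_measurable \<gamma>"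
          "integrable \<gamma> (\<lambda>\<omega>. \<bar>\<omega> (\<alpha> g u) - \<omega> (\<alpha> g0 u)\<bar> powr p)" "integrable \<gamma> (\<lambda>\<omega>. \<bar>\<omega> (b g) - \<omega> (b g0)\<bar> powr p)"
          by (auto simp: Lp_set_def)
      qed (use p in simp)
      finally show "(\<integral>\<omega>. \<bar>\<omega> (T g u) - \<omega> (T g0 u)\<bar> powr p \<partial>\<gamma>) \<le> \<dots>" .
    qed simp
    interpret convergent_coordinate_maps \<gamma> \<Phi> "\<Phi> g0" "nhds g0"
    proof
      show "sets \<gamma> = sets (PiM UNIV (\<lambda>_. borel))" using \<gamma> unfolding Gaussian_field_def by simp
      fix u :: "'v \<Rightarrow> real" and \<delta> :: real assume \<delta>: "\<delta> > 0"
      show "((\<lambda>g. prob {\<omega>. \<delta> < \<bar>\<Phi> g \<omega> u - \<Phi> g0 \<omega> u\<bar>}) \<longlongrightarrow> 0) (nhds g0)"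
      proof (cases "u \<in> Lp_set 2 M")
        case False
        then show ?thesis using \<delta> by (simp add: \<Phi>_def T_def)
      next
        case True
        show ?thesis
        proof (rule tendsto_0_sandwich)
          show "((\<lambda>g. (\<integral>\<omega>. \<bar>\<omega> (T g u) - \<omega> (T g0 u)\<bar> powr p \<partial>\<gamma>) / \<delta> powr p) \<longlongrightarrow> 0) (nhds g0)"
            by (intro tendsto_divide_zero cont_T True)
          fix g
          have dL: "(\<lambda>\<omega>. \<omega> (T g u) - \<omega> (T g0 u)) \<in> Lp_set p \<gamma>"
            using p by (intro Lp_set_diff coordL) simp
          \<comment> \<open>Markov's inequality for the power \<open>p\<close> turns
            \<open>cont_T\<close> into convergence in probability of the coordinate
            \<open>u\<close>.\<close>
          have "prob {\<omega>. \<delta> < \<bar>\<Phi> g \<omega> u - \<Phi> g0 \<omega> u\<bar>} \<le> prob {\<omega> \<in> space \<gamma>. \<delta> powr p \<le> \<bar>\<omega> (T g u) - \<omega> (T g0 u)\<bar> powr p}"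
          proof (rule finite_measure_mono)
            show "{\<omega> \<in> space \<gamma>. \<delta> powr p \<le> \<bar>\<omega> (T g u) - \<omega> (T g0 u)\<bar> powr p} \<in> events"
              using coordinate_field_measurable[OF \<gamma>] by measurable
            show "{\<omega>. \<delta> < \<bar>\<Phi> g \<omega> u - \<Phi> g0 \<omega> u\<bar>} \<subseteq> {\<omega> \<in> space \<gamma>. \<delta> powr p \<le> \<bar>\<omega> (T g u) - \<omega> (T g0 u)\<bar> powr p}"
              using \<delta> p by (auto simp: \<Phi>_def Gaussian_field_space[OF \<gamma>] intro!: powr_mono2)
          qed
          also have "\<dots> \<le> (\<integral>\<omega>. \<bar>\<omega> (T g u) - \<omega> (T g0 u)\<bar> powr p \<partial>\<gamma>) / \<delta> powr p"
            using dL \<delta> by (intro integral_Markov_inequality_measure[where A = "{}"]) (auto simp: Lp_set_def)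
          finally show "prob {\<omega>. \<delta> < \<bar>\<Phi> g \<omega> u - \<Phi> g0 \<omega> u\<bar>} \<le> (\<integral>\<omega>. \<bar>\<omega> (T g u) - \<omega> (T g0 u)\<bar> powr p \<partial>\<gamma>) / \<delta> powr p" .
        qed simp
      qed
    qed (use \<Phi> in auto)
    have F': "F \<in> borel_measurable \<gamma>" "integrable \<gamma> (\<lambda>\<omega>. \<bar>F \<omega>\<bar> powr p)"
      using F by (auto simp: Lp_set_def)
    have "((\<lambda>g. \<integral>\<omega>. \<bar>\<beta> g F \<omega> - \<beta> g0 F \<omega>\<bar> powr p \<partial>\<gamma>) \<longlongrightarrow> 0) (nhds g0)"
    proof (rule tendsto_0_sandwich)
      show "((\<lambda>g. 2 powr p * ((\<integral>\<omega>. \<bar>F (\<Phi> g \<omega>) - F (\<Phi> g0 \<omega>)\<bar> powr p \<partial>\<gamma>) + (\<integral>\<omega>. \<bar>\<omega> (b g) - \<omega> (b g0)\<bar> powr p \<partial>\<gamma>))) \<longlongrightarrow> 0) (nhds g0)"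
        using tendsto_mult_left[OF tendsto_add[OF Lp_convergence[OF F' p0] cont_field[OF zL]], of "2 powr p"] by (simp add: b_def)
      fix g
      have "(\<lambda>\<omega>. F (\<Phi> g \<omega>) - F (\<Phi> g0 \<omega>)) \<in> Lp_set p \<gamma>" "(\<lambda>\<omega>. \<omega> (b g) - \<omega> (b g0)) \<in> Lp_set p \<gamma>"
        using p by (auto intro!: Lp_set_diff coordL \<Phi>L F)
      then show "(\<integral>\<omega>. \<bar>\<beta> g F \<omega> - \<beta> g0 F \<omega>\<bar> powr p \<partial>\<gamma>) \<le>
          2 powr p * ((\<integral>\<omega>. \<bar>F (\<Phi> g \<omega>) - F (\<Phi> g0 \<omega>)\<bar> powr p \<partial>\<gamma>) + (\<integral>\<omega>. \<bar>\<omega> (b g) - \<omega> (b g0)\<bar> powr p \<partial>\<gamma>))"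
        using integrable_powr_abs_add(2)[of p "\<lambda>\<omega>. F (\<Phi> g \<omega>) - F (\<Phi> g0 \<omega>)" \<gamma> "\<lambda>\<omega>. \<omega> (b g) - \<omega> (b g0)"] p
        by (simp add: \<beta>_def Lp_set_def algebra_simps)
    qed simp
    from order_tendstoD(2)[OF Lp_dist_tendsto_0[OF p0 this] \<open>e > 0\<close>]
    show "\<exists>U. open U \<and> g0 \<in> U \<and> (\<forall>g\<in>U. Lp_dist p \<gamma> (\<beta> g F) (\<beta> g0 F) < e)"
      unfolding eventually_nhds .
  qed
  moreover have "Lp_dist p \<gamma> (\<lambda>\<omega>. \<omega> (f (g + h))) (\<beta> g (\<lambda>\<omega>. \<omega> (f h))) = 0" for g h
  proof (rule dist0[OF _ coordL \<beta>L[OF coordL]])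
    have "AE x in M. f (g + h) x = T g (f h) x + b g x"
      using ae[OF f\<alpha>[of g h] fL \<alpha>L[OF fL]] by eventually_elim (simp add: T_def fL)
    from L2_field_AE_add[OF \<gamma> fL TL[OF fL] bL this]
    show "AE \<omega> in \<gamma>. \<omega> (f (g + h)) = \<beta> g (\<lambda>\<omega>. \<omega> (f h)) \<omega>"
      by eventually_elim (simp add: \<beta>_def \<Phi>_def)
  qed
  ultimately show ?thesis
    unfolding equivariant_def using coordL by blast
qed

section \<open>Compression under proportional distances\<close>

lemma quasi_isometry_bounds_scale:
  fixes w d :: "'a \<Rightarrow> 'a \<Rightarrow> real"
  assumes c: "c > 0" and w: "\<And>g h. w g h \<ge> 0"
    and ex: "\<exists>C>0. \<exists>D>0. \<forall>g h. w g h powr r / C - D \<le> d g h \<and> d g h \<le> C * w g h"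
  shows "\<exists>C>0. \<exists>D>0. \<forall>g h. w g h powr r / C - D \<le> c * d g h \<and> c * d g h \<le> C * w g h"
proof -
  obtain C D where CD: "C > 0" "D > 0" "\<And>g h. w g h powr r / C - D \<le> d g h" "\<And>g h. d g h \<le> C * w g h"
    using ex by blast
  \<comment> \<open>One constant must serve both bounds: the lower one needs at least
    \<open>C / c\<close>, the upper one at least \<open>c * C\<close>, and the sum does
    both.\<close>
  have "\<forall>g h. w g h powr r / (C / c + c * C) - c * D \<le> c * d g h \<and> c * d g h \<le> (C / c + c * C) * w g h"
  proof (intro conjI allI)
    fix g h
    have "w g h powr r / (C / c + c * C) \<le> w g h powr r / (C / c)"
      using c CD(1) by (intro frac_le) auto
    also have "\<dots> = c * (w g h powr r / C)" by simp
    finally show "w g h powr r / (C / c + c * C) - c * D \<le> c * d g h"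
      using mult_left_mono[OF CD(3)[of g h], of c] c by (simp add: right_diff_distrib)
    have "c * d g h \<le> c * C * w g h"
      using mult_left_mono[OF CD(4)[of g h], of c] c by (simp add: mult_ac)
    also have "\<dots> \<le> (C / c + c * C) * w g h"
      using c CD(1) w by (intro mult_right_mono) auto
    finally show "c * d g h \<le> (C / c + c * C) * w g h" .
  qed
  moreover have "C / c + c * C > 0" "c * D > 0"
    using c CD(1,2) by (auto intro!: add_pos_pos)
  ultimately show ?thesis by blast
qed

lemma word_dist_nonneg: "word_dist S g h \<ge> 0"
  by (simp add: word_dist_def)

text \<open>Scaling by \<open>c\<close> and by \<open>1 / c\<close> shows that both maps admit the
  same exponents, so the suprema are taken over the same set.\<close>

lemma compression_eq_of_proportional:
  assumes c: "c > 0" and d: "\<And>g h. Lp_dist p N (f' g) (f' h) = c * Lp_dist q M (f g) (f h)"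
  shows "compression p N S f' = compression q M S f"
proof -
  have "(\<exists>C>0. \<exists>D>0. \<forall>g h. word_dist S g h powr r / C - D \<le> Lp_dist p N (f' g) (f' h) \<and>
        Lp_dist p N (f' g) (f' h) \<le> C * word_dist S g h) \<longleftrightarrow>
     (\<exists>C>0. \<exists>D>0. \<forall>g h. word_dist S g h powr r / C - D \<le> Lp_dist q M (f g) (f h) \<and>
        Lp_dist q M (f g) (f h) \<le> C * word_dist S g h)" for r
    using quasi_isometry_bounds_scale[OF c, of "word_dist S" r "\<lambda>g h. Lp_dist q M (f g) (f h)"]
      quasi_isometry_bounds_scale[of "1 / c" "word_dist S" r "\<lambda>g h. Lp_dist p N (f' g) (f' h)"]
    using c by (auto simp: d word_dist_nonneg)
  then show ?thesis unfolding compression_def by simp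
qed

lemma coarse_embedding_proportional:
  assumes c: "c > 0" and d: "\<And>g h. Lp_dist p N (f' g) (f' h) = c * Lp_dist q M (f g) (f h)"
    and f: "coarse_embedding q M S f" and f': "\<And>g. f' g \<in> Lp_set p N"
  shows "coarse_embedding p N S f'"
proof -
  obtain \<rho> C where \<rho>: "C > 0" "mono_on {0..} \<rho>" "\<And>t. t \<ge> 0 \<Longrightarrow> \<rho> t \<ge> 0" "filterlim \<rho> at_top at_top"
    "\<And>g h. \<rho> (word_dist S g h) \<le> Lp_dist q M (f g) (f h)"
    "\<And>g h. Lp_dist q M (f g) (f h) \<le> C * word_dist S g h"
    using f unfolding coarse_embedding_def by blast
  have "filterlim (\<lambda>t. c * \<rho> t) at_top at_top"
    using filterlim_tendsto_pos_mult_at_top[OF tendsto_const c \<rho>(4)] .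
  moreover have "mono_on {0..} (\<lambda>t. c * \<rho> t)"
    using \<rho>(2) c by (auto simp: mono_on_def)
  moreover have "c * Lp_dist q M (f g) (f h) \<le> c * C * word_dist S g h" for g h
    using mult_left_mono[OF \<rho>(6)[of g h], of c] c by (simp add: mult_ac)
  ultimately show ?thesis
    unfolding coarse_embedding_def d using \<rho> c f'
    by (intro conjI allI exI[of _ "\<lambda>t. c * \<rho> t"] exI[of _ "c * C"]) auto
qed

text \<open>A bound on \<open>Sup\<close> requires a nonempty set, so the point is that exponent 0
  is always admissible for a coarse embedding.\<close>

lemma compression_le_1:
  assumes f: "coarse_embedding p M S f"
  shows "compression p M S f \<le> 1"
proof -
  obtain \<rho> C where \<rho>: "C > 0" "\<And>t. t \<ge> 0 \<Longrightarrow> \<rho> t \<ge> 0"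
    "\<And>g h. \<rho> (word_dist S g h) \<le> Lp_dist p M (f g) (f h)"
    "\<And>g h. Lp_dist p M (f g) (f h) \<le> C * word_dist S g h"
    using f unfolding coarse_embedding_def by blast
  \<comment> \<open>\<open>x powr 0\<close> is 1 for nonzero \<open>x\<close> and
    \<open>0 powr 0 = 0\<close>, so with \<open>D = 1 / C\<close> the left side is never
    positive.\<close>
  have "word_dist S g h powr 0 / C - 1 / C \<le> Lp_dist p M (f g) (f h)" for g h
  proof -
    have "word_dist S g h powr 0 / C \<le> 1 / C" using \<rho>(1) by (intro divide_right_mono) auto
    moreover have "0 \<le> Lp_dist p M (f g) (f h)"
      using \<rho>(2)[OF word_dist_nonneg] \<rho>(3) by (rule order.trans)
    ultimately show ?thesis by linarith
  qed
  then have "0 \<in> {r. 0 \<le> r \<and> r \<le> 1 \<and> (\<exists>C>0. \<exists>D>0. \<forall>g h.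
        (word_dist S g h) powr r / C - D \<le> Lp_dist p M (f g) (f h) \<and>
        Lp_dist p M (f g) (f h) \<le> C * word_dist S g h)}"
    using \<rho>(1,4) by (intro CollectI conjI exI[of _ C] exI[of _ "1 / C"]) auto
  then show ?thesis unfolding compression_def by (intro cSup_least) blast+
qed

text \<open>Every compression value attained for exponent 2 is attained exactly for
  \<open>p\<close>, so one set of values contains the other. The measure spaces on the
  \<open>p\<close> side live on the sample points of the field, functions on the index type
  \<open>'w \<Rightarrow> real\<close>, which explains the type argument there.\<close>

theorem theorem4p1:
  fixes S :: "'g::{topological_group_add, t2_space} set" and p :: real
  assumes "locally_compact_space (euclidean :: 'g topology)"
    and "compact S" and "generates S"
    and "p \<ge> 1"
  shows "equiv_compression 2 TYPE('w) S \<le> equiv_compression p TYPE(('w \<Rightarrow> real) \<Rightarrow> real) S"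
  unfolding equiv_compression_def
proof (rule cSup_subset_mono)
  show "{0} \<union> {compression 2 M S f | (M :: 'w measure) f. equivariant 2 M f \<and> coarse_embedding 2 M S f} \<noteq> {}"
    by simp
  show "bdd_above ({0} \<union> {compression p M S f | (M :: (('w \<Rightarrow> real) \<Rightarrow> real) measure) f. equivariant p M f \<and> coarse_embedding p M S f})"
    by (intro bdd_aboveI[where M = 1]) (auto dest: compression_le_1)
  have "\<exists>(N :: (('w \<Rightarrow> real) \<Rightarrow> real) measure) f'. compression 2 M S f = compression p N S f' \<and>
      equivariant p N f' \<and> coarse_embedding p N S f'"
    if f: "equivariant 2 M f" "coarse_embedding 2 M S f" for M :: "'w measure" and f
  proof -
    have p: "p > 0" using assms(4) by simp
    obtain \<gamma> where \<gamma>: "Gaussian_field (L2_kernel M) \<gamma>"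
      using Gaussian_field_exists[OF psd_L2_kernel] .
    have fL: "f g \<in> Lp_set 2 M" for g using f(1) unfolding equivariant_def by blast
    have d: "Lp_dist p \<gamma> (\<lambda>\<omega>. \<omega> (f g)) (\<lambda>\<omega>. \<omega> (f h)) = std_normal_abs_moment p powr (1 / p) * Lp_dist 2 M (f g) (f h)" for g h
      by (rule L2_field_Lp_dist[OF \<gamma> p fL fL])
    have c: "std_normal_abs_moment p powr (1 / p) > 0"
      using std_normal_abs_moment_pos[OF p] by simp
    show ?thesis
      using equivariant_L2_to_Lp[OF f(1) assms(4) \<gamma>]
        compression_eq_of_proportional[OF c, of p \<gamma> "\<lambda>g \<omega>. \<omega> (f g)" 2 M f S, OF d]
        coarse_embedding_proportional[OF c d f(2) field_in_Lp(2)[OF \<gamma> p]] by metis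
  qed
  then show "{0} \<union> {compression 2 M S f | (M :: 'w measure) f. equivariant 2 M f \<and> coarse_embedding 2 M S f}
    \<subseteq> {0} \<union> {compression p M S f | (M :: (('w \<Rightarrow> real) \<Rightarrow> real) measure) f. equivariant p M f \<and> coarse_embedding p M S f}"
    by blast
qed

end
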